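(* Let $\gamma \subset S^2 \subset \mathbb{R}^3$ be a closed, simple curve of length $L$ on the unit sphere bounding a region of area $A$ in $S^2$, and denote by $\kappa$ its curvature (as a curve in $\mathbb{R}^3$), regarded as a function $\kappa(s)$ of the arc length parameter $s \in [0,L]$. Consider the two-dimensional periodic Schrödinger operator $$P_{A,L} = -\left(1+\frac{A^2}{L^2}\right)\frac{\partial^2}{\partial t^2} - 4\frac{\partial^2}{\partial s^2} - \frac{4A}{L}\frac{\partial}{\partial t}\frac{\partial}{\partial s} + \kappa^2(s)$$ defined on $[0,2\pi]\times[0,L]$. Then the spectrum of $P_{A,L}$ is bounded from below by $$\frac{4\pi^2}{L^2} \le \mu_1(P_{A,L}),$$ where $\mu_1(P_{A,L})$ is the first eigenvalue of $P_{A,L}$. Equality holds if and only if the curvature of $\gamma$ is constant.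
   Context: The curve $\gamma$ is smooth and regular, and $S^2$ is the sphere of radius $1$ in $\mathbb{R}^3$. The operator $P_{A,L}$ acts on functions $f(t,s)$ that are $2\pi$-periodic in $t$ and $L$-periodic in $s$; $\mu_1(P_{A,L})$ is its smallest eigenvalue. If $\kappa_g$ is the geodesic curvature of $\gamma$ in $S^2$, then $\kappa^2 = 1+\kappa_g^2$. *)

theory Defs
  imports "HOL-Analysis.Analysis"
begin

definition smooth :: "(real \<Rightarrow> 'a::real_normed_vector) \<Rightarrow> bool" where
  "smooth f \<longleftrightarrow>
    (\<forall>n x. ((\<lambda>g u. vector_derivative g (at u)) ^^ n) f differentiable (at x))"

(* A smooth regular simple closed curve of length L, given by its L-periodic
   arc length parametrization. *)
definition arclength_closed_curve :: "(real \<Rightarrow> real^3) \<Rightarrow> real \<Rightarrow> bool" where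
  "arclength_closed_curve \<gamma> L \<longleftrightarrow>
    L > 0 \<and> smooth \<gamma> \<and>
    (\<forall>s. norm (vector_derivative \<gamma> (at s)) = 1) \<and>
    (\<forall>s. \<gamma> (s + L) = \<gamma> s) \<and> inj_on \<gamma> {0..<L}"

(* Curvature as a curve in Euclidean 3-space, for arc length parametrizations. *)
definition curvature :: "(real \<Rightarrow> real^3) \<Rightarrow> real \<Rightarrow> real" where
  "curvature \<gamma> s =
    norm (vector_derivative (\<lambda>u. vector_derivative \<gamma> (at u)) (at s))"

(* Both regions cut out by the curve qualify; no choice is made between them. *)
definition bounds_region :: "(real^3) set \<Rightarrow> (real^3) set \<Rightarrow> bool" where
  "bounds_region \<Gamma> \<Omega> \<longleftrightarrow>
    openin (top_of_set (sphere 0 1)) \<Omega> \<and> connected \<Omega> \<and>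
    (top_of_set (sphere 0 1)) frontier_of \<Omega> = \<Gamma>"

(* Surface area on the unit sphere: the area element is sin \<theta> d\<theta> d\<phi> in the
   spherical coordinates p = (\<theta>, \<phi>) (colatitude, longitude). *)
definition sphere_area :: "(real^3) set \<Rightarrow> real" where
  "sphere_area \<Omega> = set_lebesgue_integral lborel ({0..pi} \<times> {0..2 * pi})
    (\<lambda>(\<theta>, \<phi>). indicator \<Omega>
        (vector [sin \<theta> * cos \<phi>, sin \<theta> * sin \<phi>, cos \<theta>] :: real^3) * sin \<theta>)"

definition pd_t :: "(real \<Rightarrow> real \<Rightarrow> complex) \<Rightarrow> real \<Rightarrow> real \<Rightarrow> complex" where
  "pd_t f t s = vector_derivative (\<lambda>u. f u s) (at t)"

definition pd_s :: "(real \<Rightarrow> real \<Rightarrow> complex) \<Rightarrow> real \<Rightarrow> real \<Rightarrow> complex" where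
  "pd_s f t s = vector_derivative (\<lambda>u. f t u) (at s)"

definition C1_plane :: "(real \<Rightarrow> real \<Rightarrow> complex) \<Rightarrow> bool" where
  "C1_plane f \<longleftrightarrow>
    (\<forall>t s. (\<lambda>u. f u s) differentiable (at t) \<and> (\<lambda>u. f t u) differentiable (at s)) \<and>
    continuous_on UNIV (\<lambda>(t, s). pd_t f t s) \<and>
    continuous_on UNIV (\<lambda>(t, s). pd_s f t s)"

definition C2_plane :: "(real \<Rightarrow> real \<Rightarrow> complex) \<Rightarrow> bool" where
  "C2_plane f \<longleftrightarrow> C1_plane f \<and> C1_plane (pd_t f) \<and> C1_plane (pd_s f)"

(* Functions on the torus [0, 2 pi] x [0, L], as doubly periodic functions on the
   plane. For an elliptic operator with smooth coefficients, C^2 eigenfunctions are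
   automatically smooth, and so are L^2 eigenfunctions. *)
definition periodic_C2 :: "real \<Rightarrow> (real \<Rightarrow> real \<Rightarrow> complex) set" where
  "periodic_C2 L =
    {f. C2_plane f \<and> (\<forall>t s. f (t + 2 * pi) s = f t s \<and> f t (s + L) = f t s)}"

definition P_op :: "real \<Rightarrow> real \<Rightarrow> (real \<Rightarrow> real) \<Rightarrow>
    (real \<Rightarrow> real \<Rightarrow> complex) \<Rightarrow> real \<Rightarrow> real \<Rightarrow> complex" where
  "P_op A L \<kappa> f = (\<lambda>t s.
      - complex_of_real (1 + A\<^sup>2 / L\<^sup>2) * pd_t (pd_t f) t s
      - 4 * pd_s (pd_s f) t s
      - complex_of_real (4 * A / L) * pd_t (pd_s f) t s
      + complex_of_real ((\<kappa> s)\<^sup>2) * f t s)"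

definition eigenvalue :: "(real \<Rightarrow> real \<Rightarrow> complex) set \<Rightarrow>
    ((real \<Rightarrow> real \<Rightarrow> complex) \<Rightarrow> real \<Rightarrow> real \<Rightarrow> complex) \<Rightarrow> complex \<Rightarrow> bool" where
  "eigenvalue D P \<nu> \<longleftrightarrow>
    (\<exists>f\<in>D. f \<noteq> (\<lambda>t s. 0) \<and> P f = (\<lambda>t s. \<nu> * f t s))"

(* That all eigenvalues are real is part of the assertion. *)
definition first_eigenvalue :: "(real \<Rightarrow> real \<Rightarrow> complex) set \<Rightarrow>
    ((real \<Rightarrow> real \<Rightarrow> complex) \<Rightarrow> real \<Rightarrow> real \<Rightarrow> complex) \<Rightarrow> real \<Rightarrow> bool" where
  "first_eigenvalue D P \<mu> \<longleftrightarrow>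
    eigenvalue D P (complex_of_real \<mu>) \<and>
    (\<forall>\<nu>. eigenvalue D P \<nu> \<longrightarrow> \<nu> \<in> \<real> \<and> \<mu> \<le> Re \<nu>)"

end

(* Put D = 2 d/ds + (A/L) d/dt, so that P = -d^2/dt^2 - D^2 + kappa^2. The ground state of P depends
   on s only: if g > 0 is the L-periodic ground state of -4 g'' + kappa^2 g = mu g, found by
   minimizing the energy over positive functions, then the substitution f = g h shows that every
   eigenvalue of P is real and at least mu, whatever A is.

   For the bound on mu let c = 2 pi / (total curvature), which is at most 1 by Fenchel's theorem. If
   phi' = c kappa / 2, the planar curve y = g exp(i phi) is antiperiodic, and Wirtinger's inequality
   for y reads 4 pi^2/L^2 int g^2 <= int (4 g'^2 + c^2 kappa^2 g^2) <= mu int g^2. Since kappa >= 1 on the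
   sphere, equality forces c = 1; then the curve is planar by the equality case of Fenchel's theorem,
   hence a circle. Conversely, if kappa is constant then mu = kappa^2 and the curve closes up
   after the length 2 pi / kappa, so that L = 2 pi / kappa because the curve is simple. *)
theory Submission
  imports Defs "HOL-Complex_Analysis.Great_Picard"
begin

section \<open>Wirtinger inequalities\<close>

text \<open>The factor 4 in -4 d^2/ds^2 and the half angle belong together: a planar curve that
  turns by pi over a period is antiperiodic, so each of its components vanishes somewhere and has
  the Dirichlet constant (pi/L)^2, and four times this is 4 pi^2/L^2. Turning by 2 pi would make the
  curve periodic, and Wirtinger's inequality would then ask for mean zero. The obstacle in the
  construction of g is that a minimizing sequence converges only uniformly, which says nothing about
  derivatives of the limit. Cauchy-Schwarz for the nonnegative form energy - \<mu> * mass shows that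
  the limit solves the equation weakly, with both derivatives on the test function, and in one
  dimension such a solution is classical. Positivity survives the limit only as g \<ge> 0; a zero
  would be a double zero, which uniqueness for the linear ODE excludes. Strict positivity makes q =
  2 g'/g available everywhere. The integrated identity K = (\<nu> - \<mu>) J with K \<ge> 0 and J >
  0 then yields the reality of \<nu> together with the bound, with no appeal to
  self-adjointness.\<close>

lemma has_antiderivative:
  fixes f :: "real \<Rightarrow> 'a::euclidean_space"
  assumes "continuous_on UNIV f"
  shows "\<exists>F. \<forall>x. (F has_vector_derivative f x) (at x)"
proof -
  have "\<exists>F. \<forall>x::real. -\<infinity> < ereal x \<longrightarrow> ereal x < \<infinity> \<longrightarrow> (F has_vector_derivative f x) (at x)"
    by (rule einterval_antiderivative) (use assms in \<open>auto simp: continuous_on_eq_continuous_at\<close>)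
  then show ?thesis by simp
qed

lemma integral_derivative:
  fixes f :: "real \<Rightarrow> 'a::banach"
  assumes "\<And>x. (F has_vector_derivative f x) (at x)" "a \<le> b"
  shows "integral {a..b} f = F b - F a"
  by (rule integral_unique, rule fundamental_theorem_of_calculus[OF assms(2)],
      rule has_vector_derivative_at_within, rule assms(1))

lemma integrable_continuous_UNIV:
  fixes f :: "real \<Rightarrow> 'a::banach"
  assumes "continuous_on UNIV f"
  shows "f integrable_on {a..b}"
  by (rule integrable_continuous_real[OF continuous_on_subset[OF assms subset_UNIV]])

lemma continuous_on_DERIV:
  assumes "\<And>x. (f has_real_derivative f' x) (at x)"
  shows "continuous_on S f"
  by (rule DERIV_continuous_on[OF has_field_derivative_at_within[OF assms]])

lemma integral_DERIV:
  assumes "\<And>x. (F has_real_derivative f x) (at x)" "a \<le> b"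
  shows "integral {a..b} f = F b - F a"
  by (rule integral_derivative[OF _ assms(2)])
    (simp add: assms(1) flip: has_real_derivative_iff_has_vector_derivative)

lemma has_real_antiderivative:
  fixes f :: "real \<Rightarrow> real"
  assumes "continuous_on UNIV f"
  shows "\<exists>F. \<forall>x. (F has_real_derivative f x) (at x)"
  unfolding has_real_derivative_iff_has_vector_derivative by (rule has_antiderivative[OF assms])

lemma vector_derivative_zero_imp_constant:
  fixes f :: "real \<Rightarrow> 'a::real_normed_vector"
  assumes "\<And>x. (f has_vector_derivative 0) (at x)"
  shows "f x = f y"
proof -
  have "(f has_vector_derivative 0) (at x within UNIV)" for x using assms by simp
  from has_vector_derivative_zero_constant[OF convex_UNIV this]
  obtain c where "\<And>x. x \<in> UNIV \<Longrightarrow> f x = c" by metis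
  then show ?thesis by simp
qed

text \<open>Translation by \<open>L\<close> turns \<open>f\<close> into itself, so both vectors are
  derivatives of one function at \<open>x\<close>. This is how periodicity passes to derivatives
  throughout.\<close>

lemma vector_derivative_shift_unique:
  fixes f :: "real \<Rightarrow> 'a::real_normed_vector"
  assumes "(f has_vector_derivative d) (at (x + L))" "(f has_vector_derivative d') (at x)"
    and "\<And>x. f (x + L) = f x"
  shows "d = d'"
proof -
  have "((f \<circ> (\<lambda>x. x + L)) has_vector_derivative 1 *\<^sub>R d) (at x)"
    by (rule vector_diff_chain_at) (use assms in \<open>auto intro!: derivative_eq_intros\<close>)
  then show ?thesis
    using vector_derivative_unique_at[OF _ assms(2)] by (simp add: o_def assms(3))
qed

text \<open>For an antiderivative \<open>F\<close>, the increment \<open>F (x + L) - F x\<close> has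
  derivative zero, so it is the same at \<open>a\<close> and at 0.\<close>

lemma integral_periodic_shift:
  fixes f :: "real \<Rightarrow> 'a::euclidean_space"
  assumes "continuous_on UNIV f" "\<And>x. f (x + L) = f x" "0 \<le> L"
  shows "integral {a..a + L} f = integral {0..L} f"
proof -
  obtain F where F: "\<And>x. (F has_vector_derivative f x) (at x)"
    using has_antiderivative[OF assms(1)] by blast
  have "((F \<circ> (\<lambda>x. x + L)) has_vector_derivative 1 *\<^sub>R f (x + L)) (at x)" for x
    by (intro vector_diff_chain_at F) (auto intro!: derivative_eq_intros)
  from has_vector_derivative_diff[OF this F]
  have "((\<lambda>x. F (x + L) - F x) has_vector_derivative 0) (at x)" for x
    by (simp add: o_def assms(2))
  then have "F (a + L) - F a = F (0 + L) - F 0"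
    by (rule vector_derivative_zero_imp_constant)
  moreover have "integral {a..a + L} f = F (a + L) - F a" "integral {0..L} f = F L - F 0"
    using assms(3) by (simp_all add: integral_derivative[of F f] F)
  ultimately show ?thesis by simp
qed

section \<open>Wirtinger's inequality with Dirichlet, antiperiodic and half-angle data\<close>

text \<open>If q solves the Riccati equation q' = - k^2 - q^2, then the square of u' - q u equals
  u'^2 - k^2 u^2 minus the derivative of q u^2, and the boundary terms vanish with u.\<close>

lemma Wirtinger_Dirichlet:
  fixes u u' :: "real \<Rightarrow> real"
  assumes u: "\<And>x. (u has_real_derivative u' x) (at x)" and cu': "continuous_on UNIV u'"
    and "u a = 0" "u b = 0" "a < b"
  shows "(pi / (b - a))\<^sup>2 * integral {a..b} (\<lambda>x. (u x)\<^sup>2) \<le> integral {a..b} (\<lambda>x. (u' x)\<^sup>2)"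
proof -
  have cu: "continuous_on UNIV u"
    by (rule continuous_on_DERIV[OF u])
  have cu0: "continuous_on {a..b} u" and cu0': "continuous_on {a..b} u'"
    by (rule continuous_on_subset[OF _ subset_UNIV], fact)+
  let ?I = "integral {a..b} (\<lambda>x. (u x)\<^sup>2)" and ?J = "integral {a..b} (\<lambda>x. (u' x)\<^sup>2)"
  let ?K = "pi / (b - a)"
  have K: "0 < ?K" using assms(5) by simp
  have *: "k\<^sup>2 * ?I \<le> ?J" if k: "0 < k" "k < ?K" for k
  proof -
    define c where "c = (a + b) / 2"
    \<comment> \<open>the logarithmic derivative of \<open>cos (k * (x - c))\<close>, which has no zeros in \<open>{a..b}\<close> as \<open>k < pi / (b - a)\<close>\<close>
    define q where "q = (\<lambda>x. - k * tan (k * (x - c)))"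
    have cos: "cos (k * (x - c)) > 0" if "x \<in> {a..b}" for x
    proof -
      have "\<bar>k * (x - c)\<bar> \<le> k * ((b - a) / 2)"
        using that k unfolding abs_mult c_def by (intro mult_mono) (auto simp: abs_if field_simps)
      also have "\<dots> < pi / 2"
        using k assms(5) by (simp add: field_simps)
      finally show ?thesis by (intro cos_gt_zero_pi) auto
    qed
    have dq: "(q has_real_derivative (- k\<^sup>2 - (q x)\<^sup>2)) (at x)" if "x \<in> {a..b}" for x
    proof -
      have "inverse ((cos (k * (x - c)))\<^sup>2) = 1 + (tan (k * (x - c)))\<^sup>2"
        using cos[OF that] tan_sec[of "k * (x - c)"] by (simp add: power_inverse)
      then have *: "- k * (inverse ((cos (k * (x - c)))\<^sup>2) * k) = - k\<^sup>2 - (q x)\<^sup>2"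
        unfolding q_def by (simp add: power2_eq_square algebra_simps)
      have "(q has_real_derivative (- k * (inverse ((cos (k * (x - c)))\<^sup>2) * k))) (at x)"
        unfolding q_def using cos[OF that] by (auto intro!: derivative_eq_intros)
      then show ?thesis unfolding * .
    qed
    have int: "((\<lambda>x. (- k\<^sup>2 - (q x)\<^sup>2) * (u x)\<^sup>2 + 2 * q x * u x * u' x) has_integral
          q b * (u b)\<^sup>2 - q a * (u a)\<^sup>2) {a..b}"
    proof (rule fundamental_theorem_of_calculus)
      show "((\<lambda>x. q x * (u x)\<^sup>2) has_vector_derivative
          (- k\<^sup>2 - (q x)\<^sup>2) * (u x)\<^sup>2 + 2 * q x * u x * u' x) (at x within {a..b})"
        if "x \<in> {a..b}" for x
        unfolding has_real_derivative_iff_has_vector_derivative[symmetric]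
        by (rule has_field_derivative_at_within)
          (auto intro!: derivative_eq_intros dq[OF that] u)
    qed (use assms in auto)
    have "0 \<le> integral {a..b} (\<lambda>x. (u' x)\<^sup>2 - k\<^sup>2 * (u x)\<^sup>2)"
    proof (rule has_integral_le[OF int, simplified assms, simplified])
      show "((\<lambda>x. (u' x)\<^sup>2 - k\<^sup>2 * (u x)\<^sup>2) has_integral
          integral {a..b} (\<lambda>x. (u' x)\<^sup>2 - k\<^sup>2 * (u x)\<^sup>2)) {a..b}"
        by (intro integrable_integral integrable_continuous_real continuous_intros cu0 cu0')
      show "(- k\<^sup>2 - (q x)\<^sup>2) * (u x)\<^sup>2 + 2 * q x * u x * u' x \<le> (u' x)\<^sup>2 - k\<^sup>2 * (u x)\<^sup>2" for x
        using zero_le_power2[of "u' x - q x * u x"] by (simp add: power2_eq_square algebra_simps)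
    qed
    also have "\<dots> = ?J - k\<^sup>2 * ?I"
      by (subst integral_diff) (auto intro!: integrable_continuous_real continuous_intros cu0 cu0')
    finally show ?thesis by simp
  qed
  \<comment> \<open>The inequality is closed in \<open>k\<close>, so it survives the limit to
    \<open>pi / (b - a)\<close>, where \<open>q\<close> itself blows up at both endpoints.\<close>
  show ?thesis
  proof (rule tendsto_upperbound)
    show "((\<lambda>k. k\<^sup>2 * ?I) \<longlongrightarrow> ?K\<^sup>2 * ?I) (at_left ?K)"
      by (intro tendsto_intros)
    show "\<forall>\<^sub>F k in at_left ?K. k\<^sup>2 * ?I \<le> ?J"
      using eventually_at_left_real[OF K] by eventually_elim (auto intro: *)
  qed auto
qed

text \<open>An antiperiodic function changes sign over a period, hence has a zero \<open>s\<close>,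
  and \<open>s + L\<close> is another one. The squares are periodic, so the Dirichlet inequality on
  \<open>{s..s + L}\<close> can be moved to \<open>{0..L}\<close>.\<close>

lemma Wirtinger_antiperiodic:
  fixes u u' :: "real \<Rightarrow> real"
  assumes u: "\<And>x. (u has_real_derivative u' x) (at x)" and cu': "continuous_on UNIV u'"
    and per: "\<And>x. u (x + L) = - u x" "\<And>x. u' (x + L) = - u' x" and L: "0 < L"
  shows "(pi / L)\<^sup>2 * integral {0..L} (\<lambda>x. (u x)\<^sup>2) \<le> integral {0..L} (\<lambda>x. (u' x)\<^sup>2)"
proof -
  have cu: "continuous_on UNIV u"
    by (rule continuous_on_DERIV[OF u])
  have "\<exists>s. u s = 0"
  proof (cases "u 0 \<le> 0")
    case True
    then show ?thesis
      using IVT'[of u 0 0 L] per(1)[of 0] L continuous_on_subset[OF cu] by force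
  next
    case False
    then show ?thesis
      using IVT2'[of u L 0 0] per(1)[of 0] L continuous_on_subset[OF cu] by force
  qed
  then obtain s where s: "u s = 0" by blast
  have "(pi / (s + L - s))\<^sup>2 * integral {s..s + L} (\<lambda>x. (u x)\<^sup>2) \<le> integral {s..s + L} (\<lambda>x. (u' x)\<^sup>2)"
    by (rule Wirtinger_Dirichlet[OF u cu']) (use s per L in auto)
  moreover have "integral {s..s + L} (\<lambda>x. (u x)\<^sup>2) = integral {0..L} (\<lambda>x. (u x)\<^sup>2)"
    "integral {s..s + L} (\<lambda>x. (u' x)\<^sup>2) = integral {0..L} (\<lambda>x. (u' x)\<^sup>2)"
    by (rule integral_periodic_shift; use L in \<open>simp add: per continuous_on_power cu cu'\<close>)+
  ultimately show ?thesis by simp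
qed

text \<open>
  If \<open>\<phi>' = c \<kappa> / 2\<close>, then \<open>y = g exp (\<i> \<phi>)\<close> is antiperiodic, because \<open>\<phi>\<close> grows by \<open>pi\<close> over a period,
  and \<open>4 \<bar>y'\<bar>\<^sup>2\<close> is the integrand on the right-hand side.
\<close>
lemma half_angle_inequality:
  fixes g g' \<kappa> :: "real \<Rightarrow> real"
  assumes g: "\<And>x. (g has_real_derivative g' x) (at x)" and cg': "continuous_on UNIV g'"
    and c\<kappa>: "continuous_on UNIV \<kappa>"
    and per: "\<And>x. g (x + L) = g x" "\<And>x. g' (x + L) = g' x" "\<And>x. \<kappa> (x + L) = \<kappa> x"
    and L: "0 < L" and total: "c * integral {0..L} \<kappa> = 2 * pi"
  shows "4 * pi\<^sup>2 / L\<^sup>2 * integral {0..L} (\<lambda>x. (g x)\<^sup>2)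
    \<le> integral {0..L} (\<lambda>x. 4 * (g' x)\<^sup>2 + c\<^sup>2 * (\<kappa> x)\<^sup>2 * (g x)\<^sup>2)"
proof -
  obtain K where K: "\<And>x. (K has_real_derivative \<kappa> x) (at x)"
    using has_real_antiderivative[OF c\<kappa>] by blast
  define \<phi> where "\<phi> = (\<lambda>x. c / 2 * K x)"
  have \<phi>L: "\<phi> (x + L) = \<phi> x + pi" for x
  proof -
    have "K (x + L) - K x = integral {0..L} \<kappa>"
      using integral_DERIV[OF K, of x "x + L"] integral_periodic_shift[OF c\<kappa> per(3), of x] L by simp
    then have "c / 2 * K (x + L) = c / 2 * K x + c * integral {0..L} \<kappa> / 2"
      by (simp add: algebra_simps)
    then show ?thesis unfolding \<phi>_def total by simp
  qed
  have cg: "continuous_on UNIV g"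
    by (rule continuous_on_DERIV[OF g])
  have c\<phi>: "continuous_on UNIV \<phi>"
    unfolding \<phi>_def
    by (intro continuous_intros continuous_on_DERIV[OF K])
  \<comment> \<open>Real and imaginary part of \<open>y\<close>. Their zeros need not agree, so
    Wirtinger's inequality is applied to each of them separately and the results are added.\<close>
  define u where "u = (\<lambda>x. g x * cos (\<phi> x))"
  define v where "v = (\<lambda>x. g x * sin (\<phi> x))"
  define u' where "u' = (\<lambda>x. g' x * cos (\<phi> x) - g x * (sin (\<phi> x) * (c / 2 * \<kappa> x)))"
  define v' where "v' = (\<lambda>x. g' x * sin (\<phi> x) + g x * (cos (\<phi> x) * (c / 2 * \<kappa> x)))"
  have u: "(u has_real_derivative u' x) (at x)" and v: "(v has_real_derivative v' x) (at x)" for x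
    unfolding u_def u'_def v_def v'_def \<phi>_def by (auto intro!: derivative_eq_intros g K)
  have cuv: "continuous_on UNIV u" "continuous_on UNIV v" "continuous_on UNIV u'" "continuous_on UNIV v'"
    unfolding u_def u'_def v_def v'_def by (intro continuous_intros cg cg' c\<kappa> c\<phi>)+
  have "u (x + L) = - u x" "u' (x + L) = - u' x" "v (x + L) = - v x" "v' (x + L) = - v' x" for x
    unfolding u_def u'_def v_def v'_def \<phi>L per by (simp_all add: algebra_simps)
  note Wirtinger_antiperiodic[OF u cuv(3) this(1,2) L] Wirtinger_antiperiodic[OF v cuv(4) this(3,4) L]
  then have "(pi / L)\<^sup>2 * integral {0..L} (\<lambda>x. (u x)\<^sup>2 + (v x)\<^sup>2)
      \<le> integral {0..L} (\<lambda>x. (u' x)\<^sup>2 + (v' x)\<^sup>2)"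
    by (simp add: integral_add integrable_continuous_UNIV continuous_on_power cuv distrib_left)
  also have "(\<lambda>x. (u x)\<^sup>2 + (v x)\<^sup>2) = (\<lambda>x. (g x)\<^sup>2)"
    unfolding u_def v_def by (simp add: power_mult_distrib flip: distrib_left)
  also have "(\<lambda>x. (u' x)\<^sup>2 + (v' x)\<^sup>2) = (\<lambda>x. (4 * (g' x)\<^sup>2 + c\<^sup>2 * (\<kappa> x)\<^sup>2 * (g x)\<^sup>2) / 4)"
  proof
    fix x
    have *: "(a * C - b * (S * e))\<^sup>2 + (a * S + b * (C * e))\<^sup>2 = (S\<^sup>2 + C\<^sup>2) * (a\<^sup>2 + (b * e)\<^sup>2)"
      for a b e S C :: real
      by (simp add: power2_eq_square algebra_simps)
    show "(u' x)\<^sup>2 + (v' x)\<^sup>2 = (4 * (g' x)\<^sup>2 + c\<^sup>2 * (\<kappa> x)\<^sup>2 * (g x)\<^sup>2) / 4"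
      unfolding u'_def v'_def * sin_cos_squared_add by (simp add: power2_eq_square field_simps)
  qed
  finally show ?thesis by (simp add: power_divide mult_ac)
qed

section \<open>The ground state of a periodic potential\<close>

text \<open>The point \<open>y\<close> is \<open>x\<close> minus a multiple of \<open>L\<close>
  fixed in advance, so one \<open>y\<close> serves all \<open>L\<close>-periodic functions with the
  given type of values.\<close>

lemma periodic_reduce:
  fixes L x a :: real
  assumes "0 < L"
  obtains y where "y \<in> {a..a + L}" "\<And>f::real \<Rightarrow> 'b. (\<And>x. f (x + L) = f x) \<Longrightarrow> f x = f y"
proof
  define n where "n = \<lfloor>(x - a) / L\<rfloor>"
  have "of_int n \<le> (x - a) / L" "(x - a) / L < of_int n + 1"
    unfolding n_def by linarith+
  then show "x - of_int n * L \<in> {a..a + L}"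
    using assms by (auto simp: field_simps)
  show "f x = f (x - of_int n * L)" if f: "\<And>x. f (x + L) = f x" for f :: "real \<Rightarrow> 'b"
  proof -
    have *: "f (y + real k * L) = f y" for y k
    proof (induction k)
      case (Suc k)
      have "y + real (Suc k) * L = (y + real k * L) + L" by (simp add: algebra_simps)
      then show ?case using Suc f by (simp only:)
    qed simp
    show ?thesis
    proof (cases "n \<ge> 0")
      case True
      then show ?thesis using *[of "x - of_int n * L" "nat n"] by simp
    next
      case False
      then show ?thesis using *[of x "nat (- n)"] by simp
    qed
  qed
qed

lemma antiderivative_periodic:
  fixes f F :: "real \<Rightarrow> real"
  assumes "\<And>x. (F has_real_derivative f x) (at x)" "continuous_on UNIV f" "\<And>x. f (x + L) = f x"
    and "0 \<le> L" "integral {0..L} f = 0"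
  shows "F (x + L) = F x"
  using integral_periodic_shift[OF assms(2,3,4), of x] integral_DERIV[OF assms(1), of x "x + L"] assms(4,5)
  by simp

text \<open>An antiderivative of a periodic function is periodic if the mean is zero. For
  \<open>w\<close> this is assumed; for the second integration it is arranged by subtracting the
  mean of \<open>F\<close>.\<close>

lemma periodic_second_antiderivative:
  fixes w :: "real \<Rightarrow> real"
  assumes w: "continuous_on UNIV w" "\<And>x. w (x + L) = w x" and L: "0 < L" and "integral {0..L} w = 0"
  shows "\<exists>W W'. (\<forall>x. (W has_real_derivative W' x) (at x)) \<and> (\<forall>x. (W' has_real_derivative w x) (at x))
    \<and> (\<forall>x. W (x + L) = W x) \<and> (\<forall>x. W' (x + L) = W' x)"
proof -
  obtain F where F: "\<And>x. (F has_real_derivative w x) (at x)"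
    using has_real_antiderivative[OF w(1)] by blast
  have FL: "F (x + L) = F x" for x
    using antiderivative_periodic[OF F w] assms(3,4) by simp
  have cF: "continuous_on UNIV F"
    by (rule continuous_on_DERIV[OF F])
  define W' where "W' = (\<lambda>x. F x - integral {0..L} F / L)"
  have cW': "continuous_on UNIV W'"
    unfolding W'_def by (intro continuous_intros cF)
  have W'L: "W' (x + L) = W' x" for x
    by (simp add: W'_def FL)
  have W': "(W' has_real_derivative w x) (at x)" for x
    unfolding W'_def by (auto intro!: derivative_eq_intros F)
  have intW': "integral {0..L} W' = 0"
    unfolding W'_def using L by (simp add: integral_diff integrable_continuous_UNIV cF)
  obtain W where W: "\<And>x. (W has_real_derivative W' x) (at x)"
    using has_real_antiderivative[OF cW'] by blast
  have "W (x + L) = W x" for x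
    using antiderivative_periodic[OF W cW' W'L _ intW'] L by simp
  then show ?thesis using W W' W'L by blast
qed

lemma integral_by_parts_periodic:
  fixes u v :: "real \<Rightarrow> real"
  assumes u: "\<And>x. (u has_real_derivative u' x) (at x)" "continuous_on UNIV u'" "\<And>x. u (x + L) = u x"
    and v: "\<And>x. (v has_real_derivative v' x) (at x)" "continuous_on UNIV v'" "\<And>x. v (x + L) = v x"
    and L: "0 \<le> L"
  shows "integral {0..L} (\<lambda>x. u' x * v x) = - integral {0..L} (\<lambda>x. u x * v' x)"
proof -
  have "integral {0..L} (\<lambda>x. u' x * v x + u x * v' x) = u L * v L - u 0 * v 0"
    by (rule integral_DERIV[OF _ L]) (auto intro!: derivative_eq_intros u v)
  moreover have "u L * v L = u 0 * v 0"
    using u(3)[of 0] v(3)[of 0] by simp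
  moreover have "continuous_on UNIV u" "continuous_on UNIV v"
    by (rule continuous_on_DERIV, fact)+
  ultimately show ?thesis
    by (simp add: integral_add integrable_continuous_UNIV continuous_on_mult u v)
qed

text \<open>A classical periodic solution \<open>W\<close> of \<open>W'' = w\<close> exists, and the
  equation tested with a second antiderivative of g - W - c shows that this difference is orthogonal
  to itself. So \<open>g\<close> is \<open>W\<close> up to a constant.\<close>

lemma weak_solution_regular:
  fixes g w :: "real \<Rightarrow> real"
  assumes g: "continuous_on UNIV g" "\<And>x. g (x + L) = g x"
    and w: "continuous_on UNIV w" "\<And>x. w (x + L) = w x" and L: "0 < L"
    and weak: "\<And>\<phi> \<phi>' \<phi>''. \<lbrakk>\<And>x. (\<phi> has_real_derivative \<phi>' x) (at x);
       \<And>x. (\<phi>' has_real_derivative \<phi>'' x) (at x); continuous_on UNIV \<phi>'';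
       \<And>x. \<phi> (x + L) = \<phi> x; \<And>x. \<phi>' (x + L) = \<phi>' x\<rbrakk>
       \<Longrightarrow> integral {0..L} (\<lambda>x. g x * \<phi>'' x) = integral {0..L} (\<lambda>x. w x * \<phi> x)"
  shows "\<exists>g'. (\<forall>x. (g has_real_derivative g' x) (at x)) \<and> (\<forall>x. (g' has_real_derivative w x) (at x))"
proof -
  \<comment> \<open>The constant test function yields the solvability condition for a periodic
    \<open>W\<close>.\<close>
  have "integral {0..L} w = 0"
    using weak[of "\<lambda>_. 1" "\<lambda>_. 0" "\<lambda>_. 0"] by simp
  then obtain W W' where W: "\<And>x. (W has_real_derivative W' x) (at x)"
      "\<And>x. (W' has_real_derivative w x) (at x)" "\<And>x. W (x + L) = W x" "\<And>x. W' (x + L) = W' x"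
    using periodic_second_antiderivative[OF w L] by blast
  have cW: "continuous_on UNIV W" "continuous_on UNIV W'"
    by (rule continuous_on_DERIV, fact)+
  \<comment> \<open>This constant gives \<open>h\<close> mean zero, so that \<open>h\<close> is
    itself the second derivative of a periodic test function.\<close>
  define c where "c = integral {0..L} (\<lambda>x. g x - W x) / L"
  define h where "h = (\<lambda>x. g x - W x - c)"
  have ch: "continuous_on UNIV h" and hL: "h (x + L) = h x" for x
    unfolding h_def by (auto intro!: continuous_intros cW g simp: W g)
  have inth: "integral {0..L} h = 0"
    unfolding h_def c_def using L
    by (subst integral_diff) (auto simp: intro!: integrable_continuous_UNIV continuous_intros cW g)
  then obtain \<phi> \<phi>' where \<phi>: "\<And>x. (\<phi> has_real_derivative \<phi>' x) (at x)"
      "\<And>x. (\<phi>' has_real_derivative h x) (at x)" "\<And>x. \<phi> (x + L) = \<phi> x" "\<And>x. \<phi>' (x + L) = \<phi>' x"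
    using periodic_second_antiderivative[OF ch hL L] by blast
  have c\<phi>: "continuous_on UNIV \<phi>" "continuous_on UNIV \<phi>'"
    by (rule continuous_on_DERIV, fact)+
  \<comment> \<open>Integration by parts shows that \<open>W\<close> satisfies the same weak
    equation as \<open>g\<close>. Hence \<open>h\<close> is orthogonal to g - W, and by its mean
    zero also to \<open>c\<close>.\<close>
  have "integral {0..L} (\<lambda>x. g x * h x) = integral {0..L} (\<lambda>x. w x * \<phi> x)"
    by (rule weak[OF \<phi>(1,2) ch \<phi>(3,4)])
  also have "\<dots> = - integral {0..L} (\<lambda>x. W' x * \<phi>' x)"
    using integral_by_parts_periodic[OF W(2) w(1) W(4) \<phi>(1) c\<phi>(2) \<phi>(3)] L by simp
  also have "\<dots> = integral {0..L} (\<lambda>x. W x * h x)"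
    using integral_by_parts_periodic[OF W(1) cW(2) W(3) \<phi>(2) ch \<phi>(4)] L by simp
  finally have "integral {0..L} (\<lambda>x. g x * h x - W x * h x) = 0"
    by (simp add: integral_diff integrable_continuous_UNIV continuous_on_mult g ch cW)
  moreover have "integral {0..L} (\<lambda>x. c * h x) = 0"
    by (simp add: inth)
  moreover have "(h x)\<^sup>2 = g x * h x - W x * h x - c * h x" for x
    unfolding h_def by (simp add: power2_eq_square algebra_simps)
  ultimately have "integral {0..L} (\<lambda>x. (h x)\<^sup>2) = 0"
    by (simp add: integral_diff integrable_continuous_UNIV continuous_intros g ch cW)
  then have h0: "\<forall>x\<in>{0..L}. (h x)\<^sup>2 = 0"
    by (subst (asm) integral_eq_0_iff)
      (use L in \<open>auto intro!: continuous_intros continuous_on_subset[OF ch]\<close>)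
  have "h x = 0" for x
  proof -
    obtain y where "y \<in> {0..0 + L}" "\<And>f::real \<Rightarrow> real. (\<And>x. f (x + L) = f x) \<Longrightarrow> f x = f y"
      using periodic_reduce[OF L] by metis
    from this(1) this(2)[of h, OF hL] show ?thesis using h0 by simp
  qed
  then have g_eq: "g = (\<lambda>x. W x + c)"
    unfolding h_def by (auto simp: algebra_simps)
  have "(g has_real_derivative W' x) (at x)" for x
    unfolding g_eq by (auto intro!: derivative_eq_intros W)
  then show ?thesis using W(2) by blast
qed

text \<open>Gronwall's argument: u^2 + u'^2 grows at most at the exponential rate
  \<open>1 + C\<close>, so the damped quantity \<open>e\<close> decreases from its value 0 at
  \<open>s\<close>.\<close>

lemma second_order_ODE_unique:
  fixes u u' p :: "real \<Rightarrow> real"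
  assumes u: "\<And>x. (u has_real_derivative u' x) (at x)" "\<And>x. (u' has_real_derivative p x * u x) (at x)"
    and p: "\<And>x. \<bar>p x\<bar> \<le> C" and s: "u s = 0" "u' s = 0" and "s \<le> x"
  shows "u x = 0"
proof -
  define e where "e = (\<lambda>x. ((u x)\<^sup>2 + (u' x)\<^sup>2) * exp (- (1 + C) * x))"
  define e' where "e' = (\<lambda>x. (2 * u x * u' x + 2 * u' x * (p x * u x)) * exp (- (1 + C) * x) -
     (1 + C) * ((u x)\<^sup>2 + (u' x)\<^sup>2) * exp (- (1 + C) * x))"
  have "e x \<le> e s"
  proof (rule DERIV_nonpos_imp_nonincreasing[OF \<open>s \<le> x\<close>])
    fix y
    have e: "(e has_real_derivative e' y) (at y)"
      unfolding e_def e'_def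
      by (auto intro!: derivative_eq_intros u simp: algebra_simps power2_eq_square)
    have C: "0 \<le> C" using p[of 0] by linarith
    have "2 * u y * u' y + 2 * u' y * (p y * u y) = (1 + p y) * (2 * u y * u' y)"
      by (simp add: algebra_simps)
    also have "\<dots> \<le> \<bar>1 + p y\<bar> * \<bar>2 * u y * u' y\<bar>"
      by (metis abs_ge_self abs_mult)
    also have "\<dots> \<le> (1 + C) * ((u y)\<^sup>2 + (u' y)\<^sup>2)"
    proof (rule mult_mono)
      show "\<bar>2 * u y * u' y\<bar> \<le> (u y)\<^sup>2 + (u' y)\<^sup>2"
        using zero_le_power2[of "u y - u' y"] zero_le_power2[of "u y + u' y"]
        by (simp add: abs_if power2_eq_square algebra_simps)
    qed (use p[of y] C in auto)
    finally have "e' y \<le> 0"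
      unfolding e'_def by (simp add: mult_nonpos_nonneg flip: left_diff_distrib)
    with e show "\<exists>y'. (e has_real_derivative y') (at y) \<and> y' \<le> 0" by blast
  qed
  then have "(u x)\<^sup>2 + (u' x)\<^sup>2 \<le> 0"
    unfolding e_def using s by (simp add: mult_le_0_iff)
  then show ?thesis
    by (metis add_nonneg_eq_0_iff nle_le power_eq_0_iff zero_le_power2 add_nonneg_nonneg)
qed

text \<open>Cauchy-Schwarz for g' and 1, obtained from the nonnegative variance of g' about its mean
  slope \<open>c\<close>. It turns a bound on the energy into equicontinuity with exponent
  1/2.\<close>

lemma square_increment_le:
  fixes g g' :: "real \<Rightarrow> real"
  assumes g: "\<And>x. (g has_real_derivative g' x) (at x)" "continuous_on UNIV g'" and xy: "x < y"
  shows "(g y - g x)\<^sup>2 \<le> (y - x) * integral {x..y} (\<lambda>t. (g' t)\<^sup>2)"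
proof -
  define c where "c = (g y - g x) / (y - x)"
  have "0 \<le> integral {x..y} (\<lambda>t. (g' t - c)\<^sup>2)"
    by (rule integral_nonneg) (auto intro!: integrable_continuous_UNIV continuous_intros g)
  also have "(\<lambda>t. (g' t - c)\<^sup>2) = (\<lambda>t. (g' t)\<^sup>2 + (c\<^sup>2 - 2 * c * g' t))"
    by (auto simp: power2_eq_square algebra_simps)
  also have "integral {x..y} \<dots> = integral {x..y} (\<lambda>t. (g' t)\<^sup>2) + integral {x..y} (\<lambda>t. c\<^sup>2 - 2 * c * g' t)"
    by (rule integral_add) (auto intro!: integrable_continuous_UNIV continuous_intros g)
  also have "integral {x..y} (\<lambda>t. c\<^sup>2 - 2 * c * g' t) = c\<^sup>2 * (y - x) - 2 * c * (g y - g x)"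
    using xy by (subst integral_DERIV[where F = "\<lambda>t. c\<^sup>2 * t - 2 * c * g t"])
      (auto intro!: derivative_eq_intros g simp: algebra_simps)
  also have "\<dots> = - (g y - g x)\<^sup>2 / (y - x)"
  proof -
    have c: "c * (y - x) = g y - g x" unfolding c_def using xy by simp
    have "c\<^sup>2 * (y - x) - 2 * c * (g y - g x) = c * (c * (y - x)) - 2 * c * (g y - g x)"
      by (simp add: power2_eq_square)
    then show ?thesis unfolding c by (simp add: c_def power2_eq_square)
  qed
  finally show ?thesis using xy by (simp add: field_simps)
qed

lemma periodic_Arzela_Ascoli:
  fixes F :: "nat \<Rightarrow> real \<Rightarrow> real"
  assumes per: "\<And>n x. F n (x + L) = F n x" and L: "0 < L"
    and bd: "\<And>n x. \<bar>F n x\<bar> \<le> M"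
    and eq: "\<And>n x y. \<bar>x - y\<bar> \<le> L \<Longrightarrow> (F n x - F n y)\<^sup>2 \<le> B * \<bar>x - y\<bar>" and B: "0 < B"
    and cont: "\<And>n. continuous_on UNIV (F n)"
  shows "\<exists>k h. strict_mono (k :: nat \<Rightarrow> nat) \<and> continuous_on UNIV h \<and> (\<forall>x. h (x + L) = h x) \<and>
    uniform_limit UNIV (\<lambda>n. F (k n)) h sequentially"
proof -
  have "\<exists>d>0. \<forall>n y. y \<in> {0..L} \<and> norm (x - y) < d \<longrightarrow> norm (F n x - F n y) < e"
    if x: "x \<in> {0..L}" and e: "0 < e" for x e
  \<comment> \<open>The bound on squared increments makes this radius work for all \<open>n\<close>
    at once.\<close>
  proof (intro exI[of _ "e\<^sup>2 / B"] conjI allI impI)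
    fix n y
    assume y: "y \<in> {0..L} \<and> norm (x - y) < e\<^sup>2 / B"
    have "(F n x - F n y)\<^sup>2 \<le> B * \<bar>x - y\<bar>"
      by (rule eq) (use x y in auto)
    also have "\<dots> < e\<^sup>2"
      using y B by (simp add: field_simps)
    finally show "norm (F n x - F n y) < e"
      using e by (metis abs_le_square_iff abs_of_pos linorder_not_le real_norm_def)
  qed (use B e in auto)
  then obtain g k where k: "strict_mono (k :: nat \<Rightarrow> nat)"
    and lim: "\<And>e. 0 < e \<Longrightarrow> \<exists>N. \<forall>n x. n \<ge> N \<and> x \<in> {0..L} \<longrightarrow> norm (F (k n) x - g x) < e"
    using Arzela_Ascoli[of "{0..L}" F M] bd by (metis compact_Icc real_norm_def)
  have "\<forall>x. \<exists>y. y \<in> {0..L} \<and> (\<forall>n. F n x = F n y)"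
  proof
    fix x
    obtain y where "y \<in> {0..0 + L}" "\<And>f::real \<Rightarrow> real. (\<And>x. f (x + L) = f x) \<Longrightarrow> f x = f y"
      using periodic_reduce[OF L] by metis
    then show "\<exists>y. y \<in> {0..L} \<and> (\<forall>n. F n x = F n y)" using per by auto
  qed
  \<comment> \<open>The map \<open>r\<close> reduces to one period and may jump, so the continuity
    of \<open>g \<circ> r\<close> is taken from the uniform limit instead.\<close>
  then obtain r where r: "\<And>x. r x \<in> {0..L}" "\<And>x n. F n x = F n (r x)" by metis
  have ul: "uniform_limit UNIV (\<lambda>n. F (k n)) (g \<circ> r) sequentially"
    unfolding uniform_limit_sequentially_iff dist_norm using lim r by simp metis
  have "continuous_on UNIV (g \<circ> r)"
    by (rule uniform_limit_theorem[OF _ ul]) (auto simp: cont)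
  moreover have "(g \<circ> r) (x + L) = (g \<circ> r) x" for x
    using tendsto_uniform_limitI[OF ul, of x] tendsto_uniform_limitI[OF ul, of "x + L"] per
      LIMSEQ_unique by fastforce
  ultimately show ?thesis using k ul by blast
qed

lemma tendsto_integral_mult:
  fixes F :: "nat \<Rightarrow> real \<Rightarrow> real"
  assumes "uniform_limit UNIV F h sequentially" "uniform_limit UNIV G k sequentially"
    and "\<And>n. continuous_on UNIV (F n)" "\<And>n. continuous_on UNIV (G n)"
    and "continuous_on UNIV h" "continuous_on UNIV k"
  shows "(\<lambda>n. integral {a..b} (\<lambda>x. F n x * G n x)) \<longlonglongrightarrow> integral {a..b} (\<lambda>x. h x * k x)"
proof -
  have bd: "bounded (f ` {a..b})" if "continuous_on UNIV f" for f :: "real \<Rightarrow> real"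
    by (intro compact_imp_bounded compact_continuous_image continuous_on_subset[OF that]) auto
  have ul: "uniform_limit {a..b} (\<lambda>n x. F n x * G n x) (\<lambda>x. h x * k x) sequentially"
    by (intro uniform_lim_mult bd assms uniform_limit_on_subset[OF assms(1) subset_UNIV]
        uniform_limit_on_subset[OF assms(2) subset_UNIV])
  have "continuous_on {a..b} (\<lambda>x. F n x * G n x)" for n
    by (rule continuous_on_subset[OF continuous_on_mult[OF assms(3,4)] subset_UNIV])
  from uniform_limit_integral[OF ul this trivial_limit_sequentially] obtain I J where I: "\<And>n. ((\<lambda>x. F n x * G n x) has_integral I n) {a..b}"
    and J: "((\<lambda>x. h x * k x) has_integral J) {a..b}" and "I \<longlonglongrightarrow> J"
    by blast
  moreover have "I = (\<lambda>n. integral {a..b} (\<lambda>x. F n x * G n x))"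
    by (rule ext) (rule integral_unique[OF I, symmetric])
  ultimately show ?thesis by (simp add: integral_unique)
qed

text \<open>The discriminant criterion, with the degenerate leading coefficients treated
  separately.\<close>

lemma quadratic_nonneg_imp:
  fixes a b c :: real
  assumes "\<And>t. 0 \<le> a + 2 * b * t + c * t\<^sup>2"
  shows "b\<^sup>2 \<le> a * c"
proof (cases "c = 0")
  case True
  have "b = 0"
  proof (rule ccontr)
    assume "b \<noteq> 0"
    \<comment> \<open>At this point the affine function takes the value -1.\<close>
    then show False using assms[of "- (a + 1) / (2 * b)"] True by (simp add: field_simps)
  qed
  then show ?thesis using True by simp
next
  case False
  have "c > 0"
  proof (rule ccontr)
    assume "\<not> 0 < c"
    with False have c: "c < 0" by simp
    \<comment> \<open>With \<open>c < 0\<close>, this \<open>t\<close> is so large that the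
      quadratic term outweighs the other two and leaves a value of at most
      \<open>c * t\<close>.\<close>
    define t where "t = 1 + (\<bar>a\<bar> + 2 * \<bar>b\<bar>) / (- c)"
    have t: "t \<ge> 1" "- c * t = - c + \<bar>a\<bar> + 2 * \<bar>b\<bar>"
      unfolding t_def using c by (auto simp: field_simps)
    have "c * t\<^sup>2 = - ((- c * t) * t)" by (simp add: power2_eq_square)
    also have "\<dots> = c * t - \<bar>a\<bar> * t - 2 * \<bar>b\<bar> * t" unfolding t(2) by (simp add: algebra_simps)
    finally have "a + 2 * b * t + c * t\<^sup>2 = (a - \<bar>a\<bar> * t) + 2 * t * (b - \<bar>b\<bar>) + c * t"
      by (simp add: algebra_simps)
    moreover have "a - \<bar>a\<bar> * t \<le> 0" using t(1) mult_left_mono[of 1 t "\<bar>a\<bar>"] by simp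
    moreover have "2 * t * (b - \<bar>b\<bar>) \<le> 0" using t(1) by (intro mult_nonneg_nonpos) auto
    moreover have "c * t < 0" using c t(1) by (simp add: mult_neg_pos)
    ultimately show False using assms[of t] by linarith
  qed
  then show ?thesis using assms[of "- b / c"] by (simp add: field_simps power2_eq_square)
qed

section \<open>The variational problem for -4 d^2/dx^2 + V and its positive minimizer\<close>

locale periodic_potential =
  fixes L :: real and V :: "real \<Rightarrow> real"
  assumes L: "0 < L" and cV: "continuous_on UNIV V" and perV: "\<And>x. V (x + L) = V x"
    and V_nonneg: "\<And>x. 0 \<le> V x"
begin

definition admissible :: "(real \<Rightarrow> real) \<Rightarrow> (real \<Rightarrow> real) \<Rightarrow> bool" where
  "admissible g g' \<longleftrightarrow> (\<forall>x. (g has_real_derivative g' x) (at x)) \<and> continuous_on UNIV g' \<and>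
     (\<forall>x. g (x + L) = g x)"

text \<open>The polarized quadratic form of -4 d^2/dx^2 + V. Two arguments are needed to pair a
  minimizing sequence with test functions.\<close>

definition energy :: "(real \<Rightarrow> real) \<Rightarrow> (real \<Rightarrow> real) \<Rightarrow> (real \<Rightarrow> real) \<Rightarrow> (real \<Rightarrow> real) \<Rightarrow> real" where
  "energy g g' h h' = integral {0..L} (\<lambda>x. 4 * (g' x * h' x) + V x * (g x * h x))"

text \<open>The L^2 pairing over one period.\<close>

definition mass :: "(real \<Rightarrow> real) \<Rightarrow> (real \<Rightarrow> real) \<Rightarrow> real" where
  "mass g h = integral {0..L} (\<lambda>x. g x * h x)"

definition bottom :: real where
  "bottom = Inf {energy g g' g g' |g g'. admissible g g' \<and> mass g g = 1}"

lemma admissibleD: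
  assumes "admissible g g'"
  shows "\<And>x. (g has_real_derivative g' x) (at x)" "continuous_on UNIV g'" "\<And>x. g (x + L) = g x"
    "continuous_on UNIV g"
  using assms continuous_on_DERIV[of g g' UNIV] unfolding admissible_def by auto

lemma admissible_derivative_periodic:
  assumes "admissible g g'"
  shows "g' (x + L) = g' x"
  using vector_derivative_shift_unique[of g "g' (x + L)" x L "g' x"] admissibleD(1,3)[OF assms]
  by (simp flip: has_real_derivative_iff_has_vector_derivative)

lemma admissible_lincomb:
  assumes "admissible g g'" "admissible h h'"
  shows "admissible (\<lambda>x. g x + t * h x) (\<lambda>x. g' x + t * h' x)"
  unfolding admissible_def
  using admissibleD[OF assms(1)] admissibleD[OF assms(2)]
  by (auto intro!: derivative_eq_intros continuous_intros)

lemma energy_lincomb: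
  assumes "admissible g g'" "admissible h h'"
  shows "energy (\<lambda>x. g x + t * h x) (\<lambda>x. g' x + t * h' x) (\<lambda>x. g x + t * h x) (\<lambda>x. g' x + t * h' x)
    = energy g g' g g' + 2 * energy g g' h h' * t + energy h h' h h' * t\<^sup>2"
proof -
  have *: "(\<lambda>x. 4 * ((g' x + t * h' x) * (g' x + t * h' x)) + V x * ((g x + t * h x) * (g x + t * h x)))
    = (\<lambda>x. (4 * (g' x * g' x) + V x * (g x * g x)) + ((4 * (g' x * h' x) + V x * (g x * h x)) * (2 * t)
       + (4 * (h' x * h' x) + V x * (h x * h x)) * t\<^sup>2))"
    by (auto simp: algebra_simps power2_eq_square)
  note c = admissibleD[OF assms(1)] admissibleD[OF assms(2)]
  show ?thesis
    unfolding energy_def *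
    by (simp add: integral_add integrable_continuous_UNIV continuous_on_add continuous_on_mult c cV)
qed

lemma mass_lincomb:
  assumes "continuous_on UNIV g" "continuous_on UNIV h"
  shows "mass (\<lambda>x. g x + t * h x) (\<lambda>x. g x + t * h x) = mass g g + 2 * mass g h * t + mass h h * t\<^sup>2"
proof -
  have *: "(\<lambda>x. (g x + t * h x) * (g x + t * h x))
    = (\<lambda>x. g x * g x + (g x * h x * (2 * t) + h x * h x * t\<^sup>2))"
    by (auto simp: algebra_simps power2_eq_square)
  show ?thesis
    unfolding mass_def *
    by (simp add: integral_add integrable_continuous_UNIV continuous_on_add continuous_on_mult assms)
qed

lemma mass_nonneg:
  assumes "continuous_on UNIV g"
  shows "0 \<le> mass g g"
  unfolding mass_def by (rule integral_nonneg) (auto intro!: integrable_continuous_UNIV continuous_intros assms)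

lemma energy_nonneg:
  assumes "admissible g g'"
  shows "0 \<le> energy g g' g g'"
  unfolding energy_def
  by (rule integral_nonneg)
    (auto intro!: integrable_continuous_UNIV continuous_intros admissibleD[OF assms] cV simp: V_nonneg)

text \<open>Both sides are homogeneous of degree two, so \<open>g\<close> may be scaled to mass 1.
  If the mass is zero, only the sign of the energy is needed.\<close>

lemma bottom_le_energy:
  assumes "admissible g g'"
  shows "bottom * mass g g \<le> energy g g' g g'"
proof (cases "mass g g = 0")
  case True
  then show ?thesis using energy_nonneg[OF assms] by simp
next
  case False
  then have m: "mass g g > 0"
    using mass_nonneg admissibleD(4)[OF assms] by (simp add: less_le)
  define t where "t = 1 / sqrt (mass g g)"
  have t2: "t\<^sup>2 * mass g g = 1" using m by (simp add: t_def power_divide)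
  \<comment> \<open>With the zero function as first summand, the expansion for linear combinations
    specializes to scaling by \<open>t\<close>.\<close>
  have z: "admissible (\<lambda>_. 0) (\<lambda>_. 0)" by (auto simp: admissible_def)
  note e = energy_lincomb[OF z assms, of t]
  have "mass (\<lambda>x. t * g x) (\<lambda>x. t * g x) = 1"
    using mass_lincomb[of "\<lambda>_. 0" g t] admissibleD(4)[OF assms] t2 by (simp add: mass_def mult.commute)
  moreover have "admissible (\<lambda>x. t * g x) (\<lambda>x. t * g' x)"
    using admissible_lincomb[OF z assms, of t] by simp
  ultimately have "bottom \<le> energy (\<lambda>x. t * g x) (\<lambda>x. t * g' x) (\<lambda>x. t * g x) (\<lambda>x. t * g' x)"
    unfolding bottom_def by (intro cInf_lower bdd_belowI[of _ 0]) (auto intro: energy_nonneg)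
  also have "\<dots> = energy g g' g g' * t\<^sup>2"
    using e by (simp add: energy_def)
  finally have "bottom * mass g g \<le> energy g g' g g' * (t\<^sup>2 * mass g g)"
    using m by (simp add: mult_right_mono flip: mult.assoc)
  then show ?thesis by (simp add: t2)
qed

lemma normalized_constant:
  "admissible (\<lambda>_. 1 / sqrt L) (\<lambda>_. 0)" "mass (\<lambda>_. 1 / sqrt L) (\<lambda>_. 1 / sqrt L) = 1"
  using L by (auto simp: admissible_def mass_def)

lemma bottom_nonneg: "0 \<le> bottom"
  unfolding bottom_def
  by (rule cInf_greatest) (use normalized_constant in \<open>auto intro: energy_nonneg\<close>)

text \<open>Passing from g to |g| does not raise the kinetic part, and a small smoothing keeps the
  function differentiable and makes it positive. The smoothing adds a little mass; the range from 1
  to 2 absorbs this without rescaling.\<close>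

lemma positive_almost_minimizer:
  assumes "0 < \<epsilon>" "\<epsilon> \<le> 1"
  shows "\<exists>g g'. admissible g g' \<and> (\<forall>x. 0 < g x) \<and> 1 \<le> mass g g \<and> mass g g \<le> 2 \<and>
    energy g g' g g' - bottom * mass g g \<le> \<epsilon>"
proof -
  have "\<exists>e\<in>{energy g g' g g' |g g'. admissible g g' \<and> mass g g = 1}. e < bottom + \<epsilon> / 2"
    unfolding bottom_def
    by (rule cInf_lessD) (use normalized_constant assms in auto)
  then obtain g g' where g: "admissible g g'" "mass g g = 1" and e: "energy g g' g g' < bottom + \<epsilon> / 2"
    by auto
  define I where "I = integral {0..L} V"
  have I: "0 \<le> I"
    unfolding I_def by (rule integral_nonneg) (auto intro: integrable_continuous_UNIV cV V_nonneg)
  \<comment> \<open>The smoothing raises the energy by at most \<open>d * I\<close> and the mass by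
    exactly \<open>d * L\<close>; this \<open>d\<close> keeps them below
    \<open>\<epsilon> / 2\<close> and 1.\<close>
  define d where "d = \<epsilon> / (2 * (1 + I + L))"
  have d: "0 < d" and dI: "d * I \<le> \<epsilon> / 2"
    using assms I L by (auto simp: d_def field_simps)
  have "\<epsilon> * L \<le> 1 * L"
    using assms L by (intro mult_right_mono) auto
  also have "\<dots> \<le> 2 * (1 + I + L)"
    using I L by simp
  finally have dL: "d * L \<le> 1"
    using I L by (simp add: d_def field_simps)
  \<comment> \<open>smoothed \<open>\<bar>g\<bar>\<close>: it satisfies \<open>\<bar>h'\<bar> \<le> \<bar>g'\<bar>\<close>\<close>
  define h where "h = (\<lambda>x. sqrt ((g x)\<^sup>2 + d))"
  define h' where "h' = (\<lambda>x. g x * g' x / h x)"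
  note c = admissibleD[OF g(1)]
  have hpos: "0 < h x" for x
    unfolding h_def using d by (simp add: add_nonneg_pos)
  have hsq: "h x * h x = (g x)\<^sup>2 + d" for x
    unfolding h_def using d by simp
  have ch: "continuous_on UNIV h"
    unfolding h_def by (intro continuous_intros c)
  have ch': "continuous_on UNIV h'"
    unfolding h'_def by (intro continuous_intros c ch) (use hpos in \<open>force dest: less_imp_neq\<close>)
  have h: "admissible h h'"
    unfolding admissible_def
  proof (intro conjI allI ch')
    show "(h has_real_derivative h' x) (at x)" for x
      using d hpos[of x] unfolding h_def h'_def
      by (auto intro!: derivative_eq_intros c simp: add_nonneg_pos field_simps)
    show "h (x + L) = h x" for x by (simp add: h_def c)
  qed
  have mh: "mass h h = 1 + d * L"
  proof -
    have "mass h h = integral {0..L} (\<lambda>x. g x * g x + d)"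
      unfolding mass_def hsq by (simp add: power2_eq_square)
    also have "\<dots> = mass g g + d * L"
      unfolding mass_def using L
      by (subst integral_add) (auto intro!: integrable_continuous_UNIV continuous_intros c)
    finally show ?thesis by (simp add: g)
  qed
  have "energy h h' h h' \<le> integral {0..L} (\<lambda>x. (4 * (g' x * g' x) + V x * (g x * g x)) + d * V x)"
    unfolding energy_def
  proof (rule integral_le)
    fix x
    have "h' x * h' x \<le> g' x * g' x"
    proof -
      have "h' x * h' x = (g x)\<^sup>2 / (h x * h x) * (g' x * g' x)"
        by (simp add: h'_def power2_eq_square)
      also have "\<dots> \<le> 1 * (g' x * g' x)"
        by (rule mult_right_mono) (use d in \<open>auto simp: hsq add_nonneg_pos\<close>)
      finally show ?thesis by simp
    qed
    then show "4 * (h' x * h' x) + V x * (h x * h x) \<le> 4 * (g' x * g' x) + V x * (g x * g x) + d * V x"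
      unfolding hsq by (simp add: algebra_simps power2_eq_square)
  qed (intro integrable_continuous_UNIV continuous_intros c ch ch' cV)+
  also have "\<dots> = energy g g' g g' + d * I"
    unfolding energy_def I_def
    by (subst integral_add) (auto intro!: integrable_continuous_UNIV continuous_intros c cV)
  finally have "energy h h' h h' \<le> bottom + \<epsilon>" using e dI by simp
  moreover have "bottom \<le> bottom * mass h h"
    using bottom_nonneg d L unfolding mh by (simp add: algebra_simps)
  ultimately have "energy h h' h h' - bottom * mass h h \<le> \<epsilon>" by simp
  then show ?thesis using h hpos mh d dL L by (intro exI[of _ h] exI[of _ h']) auto
qed

text \<open>The form energy - \<open>bottom\<close> * mass is positive semidefinite by
  \<open>bottom_le_energy\<close>. Along a minimizing sequence the first factor tends to 0, so the
  pairing with each fixed test function does too.\<close>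

lemma energy_form_Cauchy_Schwarz:
  assumes g: "admissible g g'" and h: "admissible h h'"
  shows "(energy g g' h h' - bottom * mass g h)\<^sup>2
    \<le> (energy g g' g g' - bottom * mass g g) * (energy h h' h h' - bottom * mass h h)"
proof (rule quadratic_nonneg_imp)
  fix t
  show "0 \<le> energy g g' g g' - bottom * mass g g + 2 * (energy g g' h h' - bottom * mass g h) * t +
      (energy h h' h h' - bottom * mass h h) * t\<^sup>2"
    using bottom_le_energy[OF admissible_lincomb[OF g h, of t]]
    unfolding energy_lincomb[OF g h] mass_lincomb[OF admissibleD(4)[OF g] admissibleD(4)[OF h]]
    by (simp add: algebra_simps)
qed

text \<open>On the right-hand side only values of \<open>g\<close> occur, and no derivatives, so it
  can be followed through a uniform limit.\<close>

lemma form_by_parts: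
  assumes g: "admissible g g'" and \<phi>: "\<And>x. (\<phi> has_real_derivative \<phi>' x) (at x)"
      "\<And>x. (\<phi>' has_real_derivative \<phi>'' x) (at x)" "continuous_on UNIV \<phi>''"
      "\<And>x. \<phi> (x + L) = \<phi> x" "\<And>x. \<phi>' (x + L) = \<phi>' x"
  shows "energy g g' \<phi> \<phi>' - \<mu> * mass g \<phi> = integral {0..L} (\<lambda>x. g x * ((V x - \<mu>) * \<phi> x - 4 * \<phi>'' x))"
proof -
  note c = admissibleD[OF g] continuous_on_DERIV[OF \<phi>(1)] continuous_on_DERIV[OF \<phi>(2)] \<phi>(3) cV
  note int = integrable_continuous_UNIV continuous_on_add continuous_on_mult continuous_on_diff
  have "integral {0..L} (\<lambda>x. g' x * \<phi>' x) = - integral {0..L} (\<lambda>x. g x * \<phi>'' x)"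
    using L by (intro integral_by_parts_periodic admissibleD[OF g] \<phi>) auto
  moreover have "energy g g' \<phi> \<phi>' = 4 * integral {0..L} (\<lambda>x. g' x * \<phi>' x) + integral {0..L} (\<lambda>x. V x * (g x * \<phi> x))"
    unfolding energy_def by (simp add: integral_add int c)
  moreover have "integral {0..L} (\<lambda>x. g x * ((V x - \<mu>) * \<phi> x - 4 * \<phi>'' x))
     = integral {0..L} (\<lambda>x. V x * (g x * \<phi> x) - (\<mu> * (g x * \<phi> x) + 4 * (g x * \<phi>'' x)))"
    by (rule arg_cong[where f = "integral {0..L}"]) (auto simp: algebra_simps)
  moreover have "\<dots> = integral {0..L} (\<lambda>x. V x * (g x * \<phi> x))
      - (\<mu> * mass g \<phi> + 4 * integral {0..L} (\<lambda>x. g x * \<phi>'' x))"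
    unfolding mass_def by (simp add: integral_add integral_diff int c)
  ultimately show ?thesis by simp
qed

theorem ground_state_exists:
  "\<exists>\<mu> g g'. (\<forall>x. 0 < g x) \<and> (\<forall>x. (g has_real_derivative g' x) (at x)) \<and>
     (\<forall>x. (g' has_real_derivative (V x - \<mu>) / 4 * g x) (at x)) \<and> (\<forall>x. g (x + L) = g x)"
proof -
  have "\<forall>n. \<exists>g g'. admissible g g' \<and> (\<forall>x. 0 < g x) \<and> 1 \<le> mass g g \<and> mass g g \<le> 2 \<and>
    energy g g' g g' - bottom * mass g g \<le> 1 / real (Suc n)"
    by (intro allI positive_almost_minimizer) auto
  then obtain G G' where G: "\<And>n. admissible (G n) (G' n)" and Gpos: "\<And>n x. 0 < G n x"
    and Gmass: "\<And>n. 1 \<le> mass (G n) (G n)" "\<And>n. mass (G n) (G n) \<le> 2"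
    and Gmin: "\<And>n. energy (G n) (G' n) (G n) (G' n) - bottom * mass (G n) (G n) \<le> 1 / real (Suc n)"
    by metis
  note c = admissibleD[OF G]
  \<comment> \<open>Mass at most 2 and an excess over the infimum of at most 1 bound the energy by
    this number.\<close>
  define B where "B = 2 * bottom + 1"
  have B: "0 < B" using bottom_nonneg by (simp add: B_def)
  have G'B: "integral {0..L} (\<lambda>x. (G' n x)\<^sup>2) \<le> B" for n
  proof -
    have "integral {0..L} (\<lambda>x. (G' n x)\<^sup>2) \<le> energy (G n) (G' n) (G n) (G' n)"
      unfolding energy_def
    proof (rule integral_le)
      show "(G' n x)\<^sup>2 \<le> 4 * (G' n x * G' n x) + V x * (G n x * G n x)" for x
        using V_nonneg[of x] mult_nonneg_nonneg[OF V_nonneg zero_le_square[of "G n x"], of x]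
          zero_le_square[of "G' n x"] unfolding power2_eq_square by linarith
    qed (intro integrable_continuous_UNIV continuous_intros c cV)+
    also have "\<dots> \<le> 1 / real (Suc n) + bottom * mass (G n) (G n)"
      using Gmin[of n] by simp
    also have "\<dots> \<le> 1 + bottom * 2"
      using bottom_nonneg Gmass by (intro add_mono mult_left_mono) auto
    finally show ?thesis by (simp add: B_def)
  qed
  have incr: "(G n y - G n x)\<^sup>2 \<le> B * (y - x)" if "x \<le> y" "y \<le> x + L" for n x y
  proof (cases "x = y")
    case False
    then have xy: "x < y" using that by simp
    have "(G n y - G n x)\<^sup>2 \<le> (y - x) * integral {x..y} (\<lambda>t. (G' n t)\<^sup>2)"
      by (rule square_increment_le[OF c(1,2) xy])
    also have "integral {x..y} (\<lambda>t. (G' n t)\<^sup>2) \<le> integral {x..x + L} (\<lambda>t. (G' n t)\<^sup>2)"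
      by (rule integral_subset_le)
        (use that in \<open>auto intro!: integrable_continuous_UNIV continuous_intros c\<close>)
    also have "\<dots> = integral {0..L} (\<lambda>t. (G' n t)\<^sup>2)"
      using L by (intro integral_periodic_shift continuous_intros c)
        (auto simp: admissible_derivative_periodic[OF G])
    also have "\<dots> \<le> B" by (rule G'B)
    finally show ?thesis using xy by (simp add: mult.commute)
  qed simp
  \<comment> \<open>A value at \<open>x\<close> differs from the others in a period by at most the
    square root of \<open>B * L\<close>, so averaging the squares over the period bounds it by the
    mass.\<close>
  have "\<bar>G n x\<bar> \<le> 1 + (4 + 2 * B * L\<^sup>2) / L" for n x
  proof -
    have "L * (G n x)\<^sup>2 = integral {x..x + L} (\<lambda>y. (G n x)\<^sup>2)"
      using L by simp
    also have "\<dots> \<le> integral {x..x + L} (\<lambda>y. 2 * (G n y * G n y) + 2 * B * L)"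
    proof (rule integral_le)
      fix y assume y: "y \<in> {x..x + L}"
      have "(G n y - G n x)\<^sup>2 \<le> B * L"
        using incr[of x y n] y B by (smt (verit) atLeastAtMost_iff mult_left_mono)
      then show "(G n x)\<^sup>2 \<le> 2 * (G n y * G n y) + 2 * B * L"
        using zero_le_power2[of "2 * G n y - G n x"] by (simp add: power2_eq_square algebra_simps)
    qed (intro integrable_continuous_UNIV continuous_intros c)+
    also have "\<dots> = 2 * integral {x..x + L} (\<lambda>y. G n y * G n y) + 2 * B * L * L"
      using L by (simp add: integral_add integrable_continuous_UNIV continuous_on_mult c)
    also have "integral {x..x + L} (\<lambda>y. G n y * G n y) = mass (G n) (G n)"
      unfolding mass_def using L by (intro integral_periodic_shift continuous_intros c) (auto simp: c)
    also have "\<dots> \<le> 2" by (rule Gmass)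
    finally have "(G n x)\<^sup>2 \<le> (4 + 2 * B * L\<^sup>2) / L"
      using L by (simp add: field_simps power2_eq_square)
    moreover have "\<bar>G n x\<bar> \<le> 1 + (G n x)\<^sup>2"
      using zero_le_power2[of "\<bar>G n x\<bar> - 1"] by (simp add: power2_eq_square algebra_simps abs_if split: if_splits)
    ultimately show ?thesis by linarith
  qed
  moreover have "(G n x - G n y)\<^sup>2 \<le> B * \<bar>x - y\<bar>" if "\<bar>x - y\<bar> \<le> L" for n x y
    using incr[of x y n] incr[of y x n] that
    by (cases "x \<le> y") (auto simp: power2_commute)
  ultimately obtain k h where k: "strict_mono (k :: nat \<Rightarrow> nat)" and ch: "continuous_on UNIV h"
    and hL: "\<And>x. h (x + L) = h x" and ul: "uniform_limit UNIV (\<lambda>n. G (k n)) h sequentially"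
    using periodic_Arzela_Ascoli[of G L _ B] c(3,4) L B by metis
  have h_nonneg: "0 \<le> h x" for x
    using LIMSEQ_le_const[OF tendsto_uniform_limitI[OF ul, of x], of 0] Gpos by (auto intro: less_imp_le)
  \<comment> \<open>The mass passes to the uniform limit, which therefore is not the zero
    function.\<close>
  have h_mass: "1 \<le> mass h h"
    unfolding mass_def
    using LIMSEQ_le_const[OF tendsto_integral_mult[OF ul ul c(4) c(4) ch ch, of 0 L], of 1] Gmass(1)
    unfolding mass_def by auto
  define w where "w = (\<lambda>x. (V x - bottom) / 4 * h x)"
  have cw: "continuous_on UNIV w"
    unfolding w_def by (intro continuous_intros ch cV) simp
  have "\<exists>h'. (\<forall>x. (h has_real_derivative h' x) (at x)) \<and> (\<forall>x. (h' has_real_derivative w x) (at x))"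
  proof (rule weak_solution_regular[OF ch hL cw _ L])
    show "w (x + L) = w x" for x by (simp add: w_def hL perV)
    fix \<phi> \<phi>' \<phi>''
    assume \<phi>: "\<And>x. (\<phi> has_real_derivative \<phi>' x) (at x)"
      "\<And>x. (\<phi>' has_real_derivative \<phi>'' x) (at x)" "continuous_on UNIV \<phi>''"
      "\<And>x. \<phi> (x + L) = \<phi> x" "\<And>x. \<phi>' (x + L) = \<phi>' x"
    note c\<phi> = continuous_on_DERIV[OF \<phi>(1), of UNIV] continuous_on_DERIV[OF \<phi>(2), of UNIV] \<phi>(3)
    have adm: "admissible \<phi> \<phi>'" unfolding admissible_def using \<phi> c\<phi> by simp
    \<comment> \<open>The operator minus \<open>bottom\<close>, applied to the test function. The
      pairing of \<open>G (k n)\<close> with it is the form value, whose square is at most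
      \<open>C / (k n + 1)\<close>.\<close>
    define \<eta> where "\<eta> = (\<lambda>x. (V x - bottom) * \<phi> x - 4 * \<phi>'' x)"
    have c\<eta>: "continuous_on UNIV \<eta>"
      unfolding \<eta>_def by (intro continuous_intros c\<phi> cV)
    define C where "C = energy \<phi> \<phi>' \<phi> \<phi>' - bottom * mass \<phi> \<phi>"
    have C: "0 \<le> C" using bottom_le_energy[OF adm] by (simp add: C_def)
    have "(integral {0..L} (\<lambda>x. G (k n) x * \<eta> x))\<^sup>2 \<le> C * (1 / real (Suc n))" for n
    proof -
      have "(integral {0..L} (\<lambda>x. G (k n) x * \<eta> x))\<^sup>2 \<le>
          (energy (G (k n)) (G' (k n)) (G (k n)) (G' (k n)) - bottom * mass (G (k n)) (G (k n))) * C"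
        using energy_form_Cauchy_Schwarz[OF G adm] form_by_parts[OF G \<phi>]
        unfolding \<eta>_def C_def by metis
      also have "\<dots> \<le> 1 / real (Suc (k n)) * C"
        by (rule mult_right_mono[OF Gmin C])
      also have "\<dots> \<le> 1 / real (Suc n) * C"
        using C seq_suble[OF k, of n] by (intro mult_right_mono divide_left_mono) auto
      finally show ?thesis by (simp add: mult.commute)
    qed
    then have "(\<lambda>n. (integral {0..L} (\<lambda>x. G (k n) x * \<eta> x))\<^sup>2) \<longlonglongrightarrow> 0"
      by (intro tendsto_sandwich[OF _ _ tendsto_const
            tendsto_mult_right_zero[OF lim_1_over_n[THEN LIMSEQ_Suc], of C]] always_eventually)
        auto
    moreover have "(\<lambda>n. (integral {0..L} (\<lambda>x. G (k n) x * \<eta> x))\<^sup>2) \<longlonglongrightarrow>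
        (integral {0..L} (\<lambda>x. h x * \<eta> x))\<^sup>2"
      by (intro tendsto_power tendsto_integral_mult ul c ch c\<eta>) (simp_all add: uniform_limit_const)
    ultimately have "integral {0..L} (\<lambda>x. h x * \<eta> x) = 0"
      using LIMSEQ_unique by fastforce
    moreover have "(\<lambda>x. h x * \<eta> x) = (\<lambda>x. 4 * (w x * \<phi> x) - 4 * (h x * \<phi>'' x))"
      unfolding \<eta>_def w_def by (auto simp: algebra_simps)
    ultimately show "integral {0..L} (\<lambda>x. h x * \<phi>'' x) = integral {0..L} (\<lambda>x. w x * \<phi> x)"
      by (simp add: integral_diff integrable_continuous_UNIV continuous_on_mult ch c\<phi> cw)
  qed
  then obtain h' where h': "\<And>x. (h has_real_derivative h' x) (at x)"
      "\<And>x. (h' has_real_derivative w x) (at x)" by blast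
  \<comment> \<open>A zero of the nonnegative \<open>h\<close> is a minimum, so \<open>h'\<close>
    vanishes there too. Uniqueness then makes \<open>h\<close> vanish on the period starting at
    \<open>s\<close>, against its mass.\<close>
  have "h s \<noteq> 0" for s
  proof
    assume s: "h s = 0"
    have "bounded (V ` {0..L})"
      by (intro compact_imp_bounded compact_continuous_image continuous_on_subset[OF cV]) auto
    then obtain K where K: "\<forall>x\<in>{0..L}. \<bar>V x\<bar> \<le> K"
      unfolding bounded_iff by auto
    have p: "\<bar>(V x - bottom) / 4\<bar> \<le> K + \<bar>bottom\<bar>" for x
    proof -
      obtain y where "y \<in> {0..0 + L}" "\<And>f::real \<Rightarrow> real. (\<And>x. f (x + L) = f x) \<Longrightarrow> f x = f y"
        using periodic_reduce[OF L] by metis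
      from this(1) this(2)[of V, OF perV] show ?thesis using bspec[OF K, of y] by auto
    qed
    have "h' s = 0"
      by (rule DERIV_local_min[OF h'(1), of 1]) (auto simp: s h_nonneg)
    then have 0: "h x = 0" if "s \<le> x" for x
      using second_order_ODE_unique[OF h'(1) h'(2)[unfolded w_def] p s _ that] by simp
    have "integral {s..s + L} (\<lambda>x. h x * h x) = integral {s..s + L} (\<lambda>x. 0)"
      by (rule integral_cong) (simp add: 0)
    moreover have "integral {s..s + L} (\<lambda>x. h x * h x) = mass h h"
      unfolding mass_def using L by (intro integral_periodic_shift continuous_intros ch) (auto simp: hL)
    ultimately show False using h_mass by simp
  qed
  then have "0 < h x" for x using h_nonneg[of x] by (simp add: less_le)
  then show ?thesis using h' hL unfolding w_def by blast
qed

end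

section \<open>The spectrum on the torus\<close>

lemma C1_planeD:
  assumes "C1_plane f"
  shows "\<And>t s. ((\<lambda>u. f u s) has_vector_derivative pd_t f t s) (at t)"
    "\<And>t s. ((\<lambda>u. f t u) has_vector_derivative pd_s f t s) (at s)"
    "continuous_on UNIV (\<lambda>(t, s). pd_t f t s)" "continuous_on UNIV (\<lambda>(t, s). pd_s f t s)"
  using assms unfolding C1_plane_def pd_t_def pd_s_def
  by (auto simp: vector_derivative_works)

text \<open>Differentiability in each variable alone gives no joint continuity. The joint continuity
  of the partial derivatives makes \<open>f\<close> totally differentiable.\<close>

lemma C1_plane_continuous:
  assumes "C1_plane f"
  shows "continuous_on UNIV (\<lambda>(t, s). f t s)"
proof -
  note f = C1_planeD[OF assms]
  have "((\<lambda>(t, s). f t s) has_derivative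
      (\<lambda>(dt, ds). dt *\<^sub>R pd_t f t s + blinfun_apply (blinfun_scaleR_left (pd_s f t s)) ds))
      (at (t, s) within UNIV \<times> UNIV)" for t s
  proof (rule has_derivative_partialsI[where fy = "\<lambda>t s. blinfun_scaleR_left (pd_s f t s)"])
    show "((\<lambda>t. f t s) has_derivative (\<lambda>dt. dt *\<^sub>R pd_t f t s)) (at t within UNIV)"
      using f(1) by (simp add: has_vector_derivative_def)
    show "((\<lambda>s. f t s) has_derivative blinfun_apply (blinfun_scaleR_left (pd_s f t s))) (at s within UNIV)" for t s
      using f(2)[of t s] by (simp add: has_vector_derivative_def)
    have "continuous_on UNIV (\<lambda>p. blinfun_scaleR_left (case p of (t, s) \<Rightarrow> pd_s f t s))"
      by (intro bounded_linear.continuous_on[OF bounded_linear_blinfun_scaleR_left] f)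
    then show "continuous (at (t, s) within UNIV \<times> UNIV) (\<lambda>(t, s). blinfun_scaleR_left (pd_s f t s))"
      by (simp add: continuous_on_eq_continuous_within split_def)
  qed auto
  then have "isCont (\<lambda>(t, s). f t s) (t, s)" for t s
    using has_derivative_continuous by (metis UNIV_Times_UNIV)
  then show ?thesis
    by (simp add: continuous_on_eq_continuous_at split_paired_All)
qed

text \<open>The increment of \<open>f t\<close> from \<open>a\<close> to \<open>u\<close> is the
  integral of \<open>pd_s f t\<close>. Differentiating it in t under the integral sign, and then in
  \<open>u\<close>, exchanges the order of the derivatives.\<close>

lemma C2_plane_mixed:
  assumes "C2_plane f"
  shows "pd_s (pd_t f) t s = pd_t (pd_s f) t s"
proof -
  have f: "C1_plane f" "C1_plane (pd_t f)" "C1_plane (pd_s f)"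
    using assms by (auto simp: C2_plane_def)
  note f0 = C1_planeD[OF f(1)] and ft = C1_planeD[OF f(2)] and fs = C1_planeD[OF f(3)]
  have c: "continuous_on S (pd_s f t)" "continuous_on S (pd_t (pd_s f) t)" for t S
  proof -
    have p: "continuous_on S (\<lambda>s. (t, s))" by (intro continuous_intros)
    show "continuous_on S (pd_s f t)" "continuous_on S (pd_t (pd_s f) t)"
      using continuous_on_compose2[OF f0(4) p] continuous_on_compose2[OF fs(3) p] by simp_all
  qed
  \<comment> \<open>A base point to the left of \<open>s\<close>, so that \<open>s\<close> lies
    inside the interval \<open>{a..s + 1}\<close> on which the two derivatives are compared.\<close>
  define a where "a = s - 1"
  have *: "pd_t f t u = pd_t f t a + integral {a..u} (pd_t (pd_s f) t)" if "a \<le> u" for u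
  proof -
    have "((\<lambda>t. integral (cbox a u) (pd_s f t)) has_vector_derivative
        integral (cbox a u) (pd_t (pd_s f) t)) (at t within UNIV)"
    proof (rule leibniz_rule_vector_derivative)
      show "continuous_on (UNIV \<times> cbox a u) (\<lambda>(t, s). pd_t (pd_s f) t s)"
        using continuous_on_subset[OF fs(3)] by blast
      show "pd_s f t integrable_on cbox a u" for t
        using c by (intro integrable_continuous)
    qed (use fs(1) in auto)
    moreover have "(\<lambda>t. integral (cbox a u) (pd_s f t)) = (\<lambda>t. f t u - f t a)"
    proof
      fix t
      have "(pd_s f t has_integral f t u - f t a) {a..u}"
        by (rule fundamental_theorem_of_calculus[OF that])
          (rule has_vector_derivative_at_within[OF f0(2)])
      then show "integral (cbox a u) (pd_s f t) = f t u - f t a" by (simp add: integral_unique)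
    qed
    ultimately have "((\<lambda>t. f t u - f t a) has_vector_derivative integral {a..u} (pd_t (pd_s f) t)) (at t)"
      by simp
    moreover have "((\<lambda>t. f t u - f t a) has_vector_derivative pd_t f t u - pd_t f t a) (at t)"
      by (intro has_vector_derivative_diff f0)
    ultimately have "integral {a..u} (pd_t (pd_s f) t) = pd_t f t u - pd_t f t a"
      by (rule vector_derivative_unique_at)
    then show ?thesis by simp
  qed
  have "((\<lambda>u. integral {a..u} (pd_t (pd_s f) t)) has_vector_derivative pd_t (pd_s f) t s)
      (at s within {a..s + 1})"
    by (rule integral_has_vector_derivative[OF c(2)]) (simp add: a_def)
  then have "((\<lambda>u. pd_t f t a + integral {a..u} (pd_t (pd_s f) t)) has_vector_derivative
      pd_t (pd_s f) t s) (at s within {a..s + 1})"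
    by (auto intro!: derivative_eq_intros)
  moreover have "((\<lambda>u. pd_t f t u) has_vector_derivative pd_s (pd_t f) t s) (at s within {a..s + 1})"
    by (rule has_vector_derivative_at_within[OF ft(2)])
  then have "((\<lambda>u. pd_t f t a + integral {a..u} (pd_t (pd_s f) t)) has_vector_derivative
      pd_s (pd_t f) t s) (at s within {a..s + 1})"
    by (rule has_vector_derivative_transform[rotated 2]) (auto simp: a_def *[unfolded a_def, symmetric])
  ultimately show ?thesis
    using vector_derivative_unique_within[of s "{a..s + 1}"]
    by (metis (no_types, lifting) a_def trivial_limit_within islimpt_Icc add_strict_mono
        atLeastAtMost_iff diff_add_cancel less_add_one less_eq_real_def less_trans)
qed

text \<open>Half of the divergence theorem on the torus: each line integral in t is a difference of
  values that agree by periodicity.\<close>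

lemma integral_pd_t_periodic:
  assumes G: "\<And>t s. ((\<lambda>u. G u s) has_vector_derivative Gt t s) (at t)"
    and c: "continuous_on UNIV (\<lambda>(t, s). Gt t s :: complex)"
    and per: "\<And>s. G T s = G 0 s" and "0 \<le> T"
  shows "integral (cbox (0, 0) (T, L)) (\<lambda>(t, s). Gt t s) = 0"
proof -
  have c': "continuous_on (cbox (0, 0) (T, L)) (\<lambda>(t, s). Gt t s)"
    by (rule continuous_on_subset[OF c]) simp
  have "integral (cbox 0 T) (\<lambda>t. Gt t s) = 0" for s
  proof -
    have "((\<lambda>t. Gt t s) has_integral G T s - G 0 s) {0..T}"
      by (rule fundamental_theorem_of_calculus[OF \<open>0 \<le> T\<close>])
        (rule has_vector_derivative_at_within[OF G])
    then show ?thesis by (simp add: per integral_unique)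
  qed
  \<comment> \<open>The integral over t has to be the inner one, hence the exchange of the order of
    integration.\<close>
  then show ?thesis
    using integral_prod_continuous[OF c'] integral_swap_continuous[OF c'] by simp
qed

lemma integral_pd_s_periodic:
  assumes G: "\<And>t s. ((\<lambda>u. G t u) has_vector_derivative Gs t s) (at s)"
    and c: "continuous_on UNIV (\<lambda>(t, s). Gs t s :: complex)"
    and per: "\<And>t. G t L = G t 0" and "0 \<le> L"
  shows "integral (cbox (0, 0) (T, L)) (\<lambda>(t, s). Gs t s) = 0"
proof -
  have c': "continuous_on (cbox (0, 0) (T, L)) (\<lambda>(t, s). Gs t s)"
    by (rule continuous_on_subset[OF c]) simp
  have "integral (cbox 0 L) (\<lambda>s. Gs t s) = 0" for t
  proof -
    have "((\<lambda>s. Gs t s) has_integral G t L - G t 0) {0..L}"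
      by (rule fundamental_theorem_of_calculus[OF \<open>0 \<le> L\<close>])
        (rule has_vector_derivative_at_within[OF G])
    then show ?thesis by (simp add: per integral_unique)
  qed
  then show ?thesis
    using integral_prod_continuous[OF c'] by simp
qed

lemma pd_periodic:
  assumes "C1_plane f" "\<And>t s. f (t + T) s = f t s" "\<And>t s. f t (s + L) = f t s"
  shows "pd_t f (t + T) s = pd_t f t s" "pd_t f t (s + L) = pd_t f t s"
    "pd_s f (t + T) s = pd_s f t s" "pd_s f t (s + L) = pd_s f t s"
proof -
  note f = C1_planeD[OF assms(1)]
  show "pd_t f (t + T) s = pd_t f t s" by (rule vector_derivative_shift_unique[OF f(1) f(1)]) (rule assms)
  show "pd_s f t (s + L) = pd_s f t s" by (rule vector_derivative_shift_unique[OF f(2) f(2)]) (rule assms)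
  show "pd_t f t (s + L) = pd_t f t s" "pd_s f (t + T) s = pd_s f t s"
    unfolding pd_t_def pd_s_def assms by simp_all
qed

section \<open>Jacobi's substitution and the lower bound for all eigenvalues\<close>

text \<open>Here a stands for f, b for its conjugate, and subscripts for derivatives; treated as
  independent symbols, they make the identity purely polynomial. The hypotheses are the eigenvalue
  equation and the Riccati equation of \<open>q\<close>. The left-hand side is a divergence, with D
  = 2 d/ds + \<alpha> d/dt.\<close>

lemma divergence_identity:
  fixes a a\<^sub>t a\<^sub>s a\<^sub>t\<^sub>t a\<^sub>t\<^sub>s a\<^sub>s\<^sub>s b b\<^sub>t b\<^sub>s q q' \<alpha> V \<mu> \<nu> :: complex
  assumes "- (1 + \<alpha>\<^sup>2) * a\<^sub>t\<^sub>t - 4 * a\<^sub>s\<^sub>s - 4 * \<alpha> * a\<^sub>t\<^sub>s + V * a = \<nu> * a"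
    and "2 * q' = V - \<mu> - q\<^sup>2"
  shows "(b\<^sub>t * a\<^sub>t + b * a\<^sub>t\<^sub>t)
      + \<alpha> * (b\<^sub>t * (2 * a\<^sub>s + \<alpha> * a\<^sub>t) + b * (2 * a\<^sub>t\<^sub>s + \<alpha> * a\<^sub>t\<^sub>t) - q * (b\<^sub>t * a + b * a\<^sub>t))
      + 2 * (b\<^sub>s * (2 * a\<^sub>s + \<alpha> * a\<^sub>t) + b * (2 * a\<^sub>s\<^sub>s + \<alpha> * a\<^sub>t\<^sub>s) - (q' * (b * a) + q * (b\<^sub>s * a + b * a\<^sub>s)))
    = (b\<^sub>t * a\<^sub>t + ((2 * b\<^sub>s + \<alpha> * b\<^sub>t) - q * b) * ((2 * a\<^sub>s + \<alpha> * a\<^sub>t) - q * a)) - (\<nu> - \<mu>) * (b * a)"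
  using assms by algebra

text \<open>
  With \<open>D = 2 \<partial>\<^sub>s + (A / L) \<partial>\<^sub>t\<close> the operator is \<open>- \<partial>\<^sub>t\<^sup>2 - D\<^sup>2 + \<kappa>\<^sup>2\<close>. Jacobi's substitution, with \<open>q = D g / g\<close>,
  gives \<open>(\<nu> - \<mu>) \<bar>f\<bar>\<^sup>2 = \<bar>\<partial>\<^sub>t f\<bar>\<^sup>2 + \<bar>D f - q f\<bar>\<^sup>2\<close> up to a divergence, which integrates to zero over the torus.
\<close>
theorem torus_spectrum_bound:
  fixes g g' :: "real \<Rightarrow> real"
  assumes L: "0 < L" and c\<kappa>: "continuous_on UNIV \<kappa>"
    and gpos: "\<And>s. 0 < g s" and g: "\<And>s. (g has_real_derivative g' s) (at s)"
      "\<And>s. (g' has_real_derivative ((\<kappa> s)\<^sup>2 - \<mu>) / 4 * g s) (at s)"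
      "\<And>s. g (s + L) = g s" "\<And>s. g' (s + L) = g' s"
    and ev: "eigenvalue (periodic_C2 L) (P_op A L \<kappa>) \<nu>"
  shows "\<nu> \<in> \<real> \<and> \<mu> \<le> Re \<nu>"
proof -
  obtain f where f: "C2_plane f" "\<And>t s. f (t + 2 * pi) s = f t s" "\<And>t s. f t (s + L) = f t s"
    and f0: "f \<noteq> (\<lambda>t s. 0)" and Pf: "P_op A L \<kappa> f = (\<lambda>t s. \<nu> * f t s)"
    using ev unfolding eigenvalue_def periodic_C2_def by blast
  have f1: "C1_plane f" and ft1: "C1_plane (pd_t f)" and fs1: "C1_plane (pd_s f)"
    using f(1) by (auto simp: C2_plane_def)
  define \<alpha> where "\<alpha> = A / L"
  define q where "q = (\<lambda>s. 2 * g' s / g s)"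
  \<comment> \<open>The second-order equation of \<open>g\<close> becomes a Riccati equation for
    \<open>q\<close>, so \<open>q'\<close> needs no derivative of \<kappa>.\<close>
  define q' where "q' = (\<lambda>s. ((\<kappa> s)\<^sup>2 - \<mu> - (q s)\<^sup>2) / 2)"
  have q: "(q has_real_derivative q' s) (at s)" for s
    using gpos[of s] unfolding q_def q'_def
    by (auto intro!: derivative_eq_intros g simp: field_simps power2_eq_square)
  have cg: "continuous_on UNIV g" "continuous_on UNIV g'"
    by (rule continuous_on_DERIV, fact)+
  have cq: "continuous_on UNIV q"
    unfolding q_def by (intro continuous_intros cg) (use gpos in \<open>force dest: less_imp_neq\<close>)
  have cq': "continuous_on UNIV q'"
    unfolding q'_def by (intro continuous_intros cq c\<kappa>) simp
  have qL: "q (s + L) = q s" for s by (simp add: q_def g)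
  define D where "D = (\<lambda>t s. 2 * pd_s f t s + of_real \<alpha> * pd_t f t s)"
  \<comment> \<open>The mixed derivative is written in the order in which it occurs in
    \<open>P_op\<close>.\<close>
  define Dt where "Dt = (\<lambda>t s. 2 * pd_t (pd_s f) t s + of_real \<alpha> * pd_t (pd_t f) t s)"
  define Ds where "Ds = (\<lambda>t s. 2 * pd_s (pd_s f) t s + of_real \<alpha> * pd_t (pd_s f) t s)"
  note df = C1_planeD(1,2)[OF f1] and dft = C1_planeD(1,2)[OF ft1] and dfs = C1_planeD(1,2)[OF fs1]
  have dD: "((\<lambda>u. D u s) has_vector_derivative Dt t s) (at t)"
    "((\<lambda>u. D t u) has_vector_derivative Ds t s) (at s)" for t s
    unfolding D_def Dt_def Ds_def C2_plane_mixed[OF f(1), symmetric]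
    using dfs dft by (auto intro!: derivative_eq_intros simp: C2_plane_mixed[OF f(1)])
  have dcnj: "((\<lambda>u. cnj (f u s)) has_vector_derivative cnj (pd_t f t s)) (at t)"
    "((\<lambda>u. cnj (f t u)) has_vector_derivative cnj (pd_s f t s)) (at s)" for t s
    by (intro has_vector_derivative_cnj df)+
  have dq: "((\<lambda>u. complex_of_real (q u)) has_vector_derivative of_real (q' s)) (at s)" for s
    using q has_vector_derivative_of_real has_real_derivative_iff_has_vector_derivative by blast
  \<comment> \<open>This is cnj f * (D f - q f). As D differentiates along the vector (\<alpha>, 2),
    the field whose divergence is integrated has the components \<open>X + \<alpha> * Y\<close> and
    \<open>2 * Y\<close>.\<close>
  define Y where "Y = (\<lambda>t s. cnj (f t s) * D t s - of_real (q s) * (cnj (f t s) * f t s))"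
  define Yt where "Yt = (\<lambda>t s. cnj (pd_t f t s) * D t s + cnj (f t s) * Dt t s
     - of_real (q s) * (cnj (pd_t f t s) * f t s + cnj (f t s) * pd_t f t s))"
  define Ys where "Ys = (\<lambda>t s. cnj (pd_s f t s) * D t s + cnj (f t s) * Ds t s
     - (of_real (q' s) * (cnj (f t s) * f t s)
        + of_real (q s) * (cnj (pd_s f t s) * f t s + cnj (f t s) * pd_s f t s)))"
  define X where "X = (\<lambda>t s. cnj (f t s) * pd_t f t s)"
  define Xt where "Xt = (\<lambda>t s. cnj (pd_t f t s) * pd_t f t s + cnj (f t s) * pd_t (pd_t f) t s)"
  have dX: "((\<lambda>u. X u s + of_real \<alpha> * Y u s) has_vector_derivative Xt t s + of_real \<alpha> * Yt t s) (at t)" for t s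
    unfolding X_def Xt_def Y_def Yt_def
    by (rule has_vector_derivative_eq_rhs,
        (rule has_vector_derivative_add has_vector_derivative_diff has_vector_derivative_mult
          has_vector_derivative_mult_right dcnj df dft dD)+) (simp add: algebra_simps)
  have dY: "((\<lambda>u. 2 * Y t u) has_vector_derivative 2 * Ys t s) (at s)" for t s
    unfolding Y_def Ys_def
    by (rule has_vector_derivative_eq_rhs,
        (rule has_vector_derivative_mult_right has_vector_derivative_diff has_vector_derivative_mult
          dcnj df dD dq)+) (simp add: algebra_simps)
  note cont = C1_plane_continuous[OF f1] C1_plane_continuous[OF ft1] C1_plane_continuous[OF fs1]
    C1_planeD(3,4)[OF ft1] C1_planeD(3,4)[OF fs1]
  note cont' = cont[unfolded split_def]
  have c1: "continuous_on UNIV (\<lambda>p::real \<times> real. h (snd p))" if "continuous_on UNIV h" for h :: "real \<Rightarrow> real"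
    by (rule continuous_on_compose2[OF that]) (auto intro!: continuous_intros)
  have cX: "continuous_on UNIV (\<lambda>(t, s). Xt t s + of_real \<alpha> * Yt t s)"
    and cY: "continuous_on UNIV (\<lambda>(t, s). 2 * Ys t s)"
    unfolding Xt_def Yt_def Ys_def D_def Dt_def Ds_def split_def
    by (intro continuous_intros cont' c1 cq cq')+
  have per: "f (2 * pi) s = f 0 s" "f t L = f t 0" "pd_t f (2 * pi) s = pd_t f 0 s"
    "pd_t f t L = pd_t f t 0" "pd_s f (2 * pi) s = pd_s f 0 s" "pd_s f t L = pd_s f t 0" for t s
    using f(2)[of 0 s] f(3)[of t 0] pd_periodic[OF f1 f(2,3), of 0 s] pd_periodic[OF f1 f(2,3), of t 0]
    by simp_all
  let ?B = "cbox (0, 0) (2 * pi, L)"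
  define R where "R = (\<lambda>t s. (cmod (pd_t f t s))\<^sup>2 + (cmod (D t s - of_real (q s) * f t s))\<^sup>2)"
  have "Xt t s + of_real \<alpha> * Yt t s + 2 * Ys t s = of_real (R t s) - (\<nu> - of_real \<mu>) * of_real ((cmod (f t s))\<^sup>2)"
    for t s
  proof -
    have "P_op A L \<kappa> f t s = \<nu> * f t s" by (simp add: Pf)
    then have "- (1 + (of_real \<alpha>)\<^sup>2) * pd_t (pd_t f) t s - 4 * pd_s (pd_s f) t s
        - 4 * of_real \<alpha> * pd_t (pd_s f) t s + of_real ((\<kappa> s)\<^sup>2) * f t s = \<nu> * f t s"
      unfolding P_op_def \<alpha>_def by (simp add: power_divide)
    from divergence_identity[OF this, where b = "cnj (f t s)" and a\<^sub>t = "pd_t f t s" and a\<^sub>s = "pd_s f t s"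
        and b\<^sub>t = "cnj (pd_t f t s)" and b\<^sub>s = "cnj (pd_s f t s)"
        and q = "of_real (q s)" and q' = "of_real (q' s)" and \<mu> = "of_real \<mu>"]
    have "Xt t s + of_real \<alpha> * Yt t s + 2 * Ys t s =
        (cnj (pd_t f t s) * pd_t f t s + ((2 * cnj (pd_s f t s) + of_real \<alpha> * cnj (pd_t f t s))
           - of_real (q s) * cnj (f t s)) * (D t s - of_real (q s) * f t s))
        - (\<nu> - of_real \<mu>) * (cnj (f t s) * f t s)"
      unfolding Xt_def Yt_def Ys_def D_def Dt_def Ds_def by (simp add: q'_def)
    also have "2 * cnj (pd_s f t s) + of_real \<alpha> * cnj (pd_t f t s) - of_real (q s) * cnj (f t s)
        = cnj (D t s - of_real (q s) * f t s)"
      by (simp add: D_def)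
    finally show ?thesis
      unfolding R_def of_real_add complex_norm_square by (simp add: mult.commute)
  qed
  then have R_eq: "of_real (R t s) =
      (Xt t s + of_real \<alpha> * Yt t s) + (2 * Ys t s + (\<nu> - of_real \<mu>) * of_real ((cmod (f t s))\<^sup>2))" for t s
    by (simp add: algebra_simps)
  have cR: "continuous_on S (\<lambda>(t, s). R t s)" and cN: "continuous_on S (\<lambda>(t, s). (cmod (f t s))\<^sup>2)" for S
    unfolding R_def D_def split_def
    by (rule continuous_on_subset[OF _ subset_UNIV], intro continuous_intros cont' c1 cq)+
  have int: "h integrable_on ?B" if "continuous_on UNIV h" for h :: "real \<times> real \<Rightarrow> complex"
    by (intro integrable_continuous continuous_on_subset[OF that]) simp
  have cN': "continuous_on UNIV (\<lambda>(t, s). complex_of_real ((cmod (f t s))\<^sup>2))"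
    using cN[of UNIV] unfolding split_def by (intro continuous_on_of_real)
  have int_of_real: "integral ?B (\<lambda>(t, s). complex_of_real (h t s)) = of_real (integral ?B (\<lambda>(t, s). h t s))"
    if "continuous_on ?B (\<lambda>(t, s). h t s)" for h
    using integral_linear[OF integrable_continuous[OF that] bounded_linear_of_real]
    by (simp add: o_def split_def)
  define J where "J = integral ?B (\<lambda>(t, s). (cmod (f t s))\<^sup>2)"
  define K where "K = integral ?B (\<lambda>(t, s). R t s)"
  have K: "0 \<le> K"
    unfolding K_def by (intro integral_nonneg integrable_continuous cR) (auto simp: R_def)
  have "complex_of_real K = integral ?B (\<lambda>(t, s). of_real (R t s))"
    unfolding K_def by (rule int_of_real[OF cR, symmetric])
  also have "\<dots> = integral ?B (\<lambda>p. (case p of (t, s) \<Rightarrow> Xt t s + of_real \<alpha> * Yt t s)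
      + ((case p of (t, s) \<Rightarrow> 2 * Ys t s)
      + (\<nu> - of_real \<mu>) * (case p of (t, s) \<Rightarrow> complex_of_real ((cmod (f t s))\<^sup>2))))"
    by (rule arg_cong[where f = "integral ?B"]) (auto simp: R_eq)
  also have "\<dots> = integral ?B (\<lambda>(t, s). Xt t s + of_real \<alpha> * Yt t s)
      + (integral ?B (\<lambda>(t, s). 2 * Ys t s)
      + (\<nu> - of_real \<mu>) * integral ?B (\<lambda>(t, s). complex_of_real ((cmod (f t s))\<^sup>2)))"
    by (simp only: integral_add integral_mult_right int continuous_on_add continuous_on_mult continuous_on_const cX cY cN')
  also have "integral ?B (\<lambda>(t, s). Xt t s + of_real \<alpha> * Yt t s) = 0"
    by (rule integral_pd_t_periodic[OF dX cX]) (auto simp: X_def Y_def D_def per)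
  also have "integral ?B (\<lambda>(t, s). 2 * Ys t s) = 0"
    by (rule integral_pd_s_periodic[OF dY cY])
      (use L qL[of 0] in \<open>auto simp: Y_def D_def per\<close>)
  also have "integral ?B (\<lambda>(t, s). complex_of_real ((cmod (f t s))\<^sup>2)) = of_real J"
    unfolding J_def by (rule int_of_real[OF cN])
  finally have KJ: "complex_of_real K = (\<nu> - of_real \<mu>) * of_real J" by simp
  have "J \<noteq> 0"
  proof
    assume "J = 0"
    then have z: "\<forall>p\<in>?B. (case p of (t, s) \<Rightarrow> (cmod (f t s))\<^sup>2) = 0"
      unfolding J_def
      by (subst (asm) integral_cbox_eq_0_iff)
        (use L in \<open>auto intro: cN simp: box_ne_empty Basis_prod_def\<close>)
    have "f t s = 0" for t s
    proof -
      have pi2: "0 < 2 * pi" by simp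
      obtain t' where t': "t' \<in> {0..0 + 2 * pi}" "\<And>h::real \<Rightarrow> complex. (\<And>x. h (x + 2 * pi) = h x) \<Longrightarrow> h t = h t'"
        using periodic_reduce[OF pi2] by metis
      obtain s' where s': "s' \<in> {0..0 + L}" "\<And>h::real \<Rightarrow> complex. (\<And>x. h (x + L) = h x) \<Longrightarrow> h s = h s'"
        using periodic_reduce[OF L] by metis
      have "f t s = f t' s" by (rule t'(2)) (rule f)
      also have "\<dots> = f t' s'" by (rule s'(2)) (rule f)
      also have "\<dots> = 0"
        using bspec[OF z, of "(t', s')"] t'(1) s'(1) by (auto simp: cbox_Pair_eq)
      finally show ?thesis .
    qed
    then show False using f0 by blast
  qed
  moreover have "0 \<le> J"
    unfolding J_def by (intro integral_nonneg integrable_continuous cN) auto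
  ultimately have J: "0 < J" by simp
  \<comment> \<open>A real \<open>K\<close> and a positive \<open>J\<close> make \<nu> real, and the
    sign of \<open>K\<close> gives the bound.\<close>
  have "\<nu> = of_real (\<mu> + K / J)"
    using KJ J by (simp add: field_simps)
  then show ?thesis using K J by simp
qed

section \<open>Functions of s alone as eigenfunctions\<close>

lemma
  fixes h h' :: "real \<Rightarrow> real"
  assumes h: "\<And>s. (h has_real_derivative h' s) (at s)"
  shows pd_t_lift: "pd_t (\<lambda>t s. complex_of_real (h s)) = (\<lambda>t s. 0)"
    and pd_s_lift: "pd_s (\<lambda>t s. complex_of_real (h s)) = (\<lambda>t s. complex_of_real (h' s))"
    and C1_plane_lift: "continuous_on UNIV h' \<Longrightarrow> C1_plane (\<lambda>t s. complex_of_real (h s))"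
proof -
  have d: "((\<lambda>s. complex_of_real (h s)) has_vector_derivative complex_of_real (h' s)) (at s)" for s
    using h has_vector_derivative_of_real has_real_derivative_iff_has_vector_derivative by blast
  show t: "pd_t (\<lambda>t s. complex_of_real (h s)) = (\<lambda>t s. 0)"
    unfolding pd_t_def by simp
  show s: "pd_s (\<lambda>t s. complex_of_real (h s)) = (\<lambda>t s. complex_of_real (h' s))"
    unfolding pd_s_def using vector_derivative_at[OF d] by simp
  show "C1_plane (\<lambda>t s. complex_of_real (h s))" if "continuous_on UNIV h'"
  proof -
    have "continuous_on UNIV (\<lambda>p::real \<times> real. h' (snd p))"
      by (rule continuous_on_compose2[OF that]) (auto intro!: continuous_intros)
    then have "continuous_on UNIV (\<lambda>(t::real, s). complex_of_real (h' s))"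
      unfolding split_def by (intro continuous_intros)
    moreover have "(\<lambda>s. complex_of_real (h s)) differentiable (at s)" for s
      using d differentiableI_vector by blast
    ultimately show ?thesis
      unfolding C1_plane_def t s by (auto simp: split_def)
  qed
qed

text \<open>All terms with a t-derivative vanish on functions of s alone, which leaves the operator
  -4 d^2/ds^2 + \<kappa>^2.\<close>

lemma ground_state_eigenvalue:
  assumes c\<kappa>: "continuous_on UNIV \<kappa>" and g0: "g \<noteq> (\<lambda>s. 0)"
    and g: "\<And>s. (g has_real_derivative g' s) (at s)"
      "\<And>s. (g' has_real_derivative ((\<kappa> s)\<^sup>2 - \<mu>) / 4 * g s) (at s)" "\<And>s. g (s + L) = g s"
  shows "eigenvalue (periodic_C2 L) (P_op A L \<kappa>) (complex_of_real \<mu>)"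
  unfolding eigenvalue_def
proof (rule bexI, intro conjI)
  let ?f = "\<lambda>(t::real) s. complex_of_real (g s)"
  have cg: "continuous_on UNIV g" "continuous_on UNIV g'"
    by (rule continuous_on_DERIV, fact)+
  have cg'': "continuous_on UNIV (\<lambda>s. ((\<kappa> s)\<^sup>2 - \<mu>) / 4 * g s)"
    by (intro continuous_intros c\<kappa> cg) simp
  have z: "C1_plane (\<lambda>t s. 0)"
    using C1_plane_lift[of "\<lambda>s. 0" "\<lambda>s. 0"] by simp
  show "?f \<in> periodic_C2 L"
    unfolding periodic_C2_def C2_plane_def
    by (simp add: pd_t_lift[OF g(1)] pd_s_lift[OF g(1)] C1_plane_lift[OF g(1) cg(2)]
        C1_plane_lift[OF g(2) cg''] z g(3))
  show "?f \<noteq> (\<lambda>t s. 0)" using g0 by (auto simp: fun_eq_iff)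
  show "P_op A L \<kappa> ?f = (\<lambda>t s. complex_of_real \<mu> * ?f t s)"
    unfolding P_op_def pd_t_lift[OF g(1)] pd_s_lift[OF g(1)] pd_t_lift[OF g(2)] pd_s_lift[OF g(2)]
    using pd_t_lift[of "\<lambda>s. 0" "\<lambda>s. 0"]
    by (simp add: fun_eq_iff field_simps)
qed

section \<open>Total curvature and the equality case\<close>

text \<open>On the unit sphere the distance of two points is at most the length of a curve joining
  them. As \<open>T'\<close> is orthogonal to \<open>T\<close>, only the part of the starting point
  p orthogonal to \<open>T\<close> contributes to its pairing with \<open>T'\<close>, and this part
  has length sqrt (1 - (p \<bullet> T s)^2), which is the reciprocal of the factor from the
  derivative of \<open>arccos\<close>.\<close>

lemma arccos_inner_le_arc:
  fixes T :: "real \<Rightarrow> 'a::real_inner"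
  assumes T: "\<And>s. (T has_vector_derivative T' s) (at s)" and unit: "\<And>s. norm (T s) = 1"
    and \<psi>: "\<And>s. (\<psi> has_real_derivative norm (T' s)) (at s)" and "a \<le> b"
  shows "arccos (T a \<bullet> T b) \<le> \<psi> b - \<psi> a"
proof -
  define p where "p = T a"
  have p: "norm p = 1" by (simp add: p_def unit)
  have h1: "\<bar>p \<bullet> T s\<bar> \<le> 1" for s
    using Cauchy_Schwarz_ineq2[of p "T s"] by (simp add: p unit)
  have orth: "T s \<bullet> T' s = 0" for s
  proof -
    have "((\<lambda>s. T s \<bullet> T s) has_vector_derivative T s \<bullet> T' s + T' s \<bullet> T s) (at s)"
      by (rule bounded_bilinear.has_vector_derivative[OF bounded_bilinear_inner T T])
    moreover have "(\<lambda>s. T s \<bullet> T s) = (\<lambda>s. 1)"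
      using unit by (simp add: dot_square_norm)
    ultimately have "T s \<bullet> T' s + T' s \<bullet> T s = 0"
      using vector_derivative_unique_at[OF _ has_vector_derivative_const] by simp
    then show ?thesis by (simp add: inner_commute)
  qed
  have speed: "\<bar>p \<bullet> T' s\<bar> \<le> norm (T' s) * sqrt (1 - (p \<bullet> T s)\<^sup>2)" for s
  proof -
    have "p \<bullet> T' s = (p - (p \<bullet> T s) *\<^sub>R T s) \<bullet> T' s"
      by (simp add: inner_diff_left orth)
    then have "\<bar>p \<bullet> T' s\<bar> \<le> norm (p - (p \<bullet> T s) *\<^sub>R T s) * norm (T' s)"
      using Cauchy_Schwarz_ineq2 by metis
    moreover have "(norm (p - (p \<bullet> T s) *\<^sub>R T s))\<^sup>2 = 1 - (p \<bullet> T s)\<^sup>2"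
      using p unit[of s] unfolding power2_norm_eq_inner norm_eq_1
      by (simp add: inner_diff_left inner_diff_right inner_commute power2_eq_square algebra_simps)
    then have "norm (p - (p \<bullet> T s) *\<^sub>R T s) = sqrt (1 - (p \<bullet> T s)\<^sup>2)"
      by (metis norm_ge_zero real_sqrt_unique)
    ultimately show ?thesis by (simp add: mult.commute)
  qed
  \<comment> \<open>\<open>arccos\<close> is not differentiable at the endpoints, hence the factor \<open>c < 1\<close>, which tends to 1 below\<close>
  have *: "arccos (c * (p \<bullet> T b)) - arccos c \<le> \<psi> b - \<psi> a" if c: "0 < c" "c < 1" for c
  proof -
    let ?h = "\<lambda>s. c * (p \<bullet> T s)"
    have hc: "\<bar>?h s\<bar> < 1" for s
    proof -
      have "\<bar>?h s\<bar> \<le> c * 1"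
        unfolding abs_mult using h1 c by (intro mult_mono) auto
      then show ?thesis using c by simp
    qed
    have "((\<lambda>s. p \<bullet> T s) has_real_derivative p \<bullet> T' s) (at s)" for s
      unfolding has_real_derivative_iff_has_vector_derivative
      by (rule bounded_linear.has_vector_derivative[OF bounded_linear_inner_right T])
    then have dh: "(?h has_real_derivative c * (p \<bullet> T' s)) (at s)" for s
      by (rule DERIV_cmult)
    have "\<psi> a - arccos (?h a) \<le> \<psi> b - arccos (?h b)"
    proof (rule DERIV_nonneg_imp_nondecreasing[OF \<open>a \<le> b\<close>])
      fix s
      have pos: "0 < 1 - (?h s)\<^sup>2"
        using hc[of s] by (simp add: abs_square_less_1)
      have "((\<lambda>s. \<psi> s - arccos (?h s)) has_real_derivative
          norm (T' s) - inverse (- sqrt (1 - (?h s)\<^sup>2)) * (c * (p \<bullet> T' s))) (at s)"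
        using hc[of s] by (intro DERIV_diff \<psi> DERIV_chain2[OF DERIV_arccos dh]) auto
      moreover have "- (c * (p \<bullet> T' s)) \<le> norm (T' s) * sqrt (1 - (?h s)\<^sup>2)"
      proof -
        have "- (c * (p \<bullet> T' s)) \<le> c * \<bar>p \<bullet> T' s\<bar>"
          using c mult_left_mono[OF abs_ge_minus_self[of "p \<bullet> T' s"], of c] by simp
        also have "\<dots> \<le> c * (norm (T' s) * sqrt (1 - (p \<bullet> T s)\<^sup>2))"
          using c speed by (intro mult_left_mono) auto
        also have "\<dots> = norm (T' s) * sqrt (c\<^sup>2 * (1 - (p \<bullet> T s)\<^sup>2))"
          using c by (simp add: real_sqrt_mult)
        also have "\<dots> \<le> norm (T' s) * sqrt (1 - (?h s)\<^sup>2)"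
          using c by (intro mult_left_mono) (auto simp: power_mult_distrib algebra_simps power_le_one)
        finally show ?thesis .
      qed
      then have "0 \<le> norm (T' s) - inverse (- sqrt (1 - (?h s)\<^sup>2)) * (c * (p \<bullet> T' s))"
        using pos by (simp add: field_simps)
      ultimately show "\<exists>y. ((\<lambda>s. \<psi> s - arccos (?h s)) has_real_derivative y) (at s) \<and> 0 \<le> y"
        by blast
    qed
    moreover have "p \<bullet> T a = 1" using p by (simp add: p_def norm_eq_1)
    ultimately show ?thesis by simp
  qed
  have acc: "continuous_on {-1..1} arccos" by (rule continuous_on_arccos')
  have "((\<lambda>c. arccos (c * (p \<bullet> T b)) - arccos c) \<longlongrightarrow> arccos (1 * (p \<bullet> T b)) - arccos 1) (at 1 within {0..1})"
  proof -
    have "continuous_on {0..1} (\<lambda>c. arccos (c * (p \<bullet> T b)) - arccos c)"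
    proof (intro continuous_on_diff continuous_on_compose2[OF acc] continuous_intros)
      show "(\<lambda>c. c * (p \<bullet> T b)) ` {0..1} \<subseteq> {- 1..1}"
      proof safe
        fix c :: real assume "c \<in> {0..1}"
        then have "\<bar>c * (p \<bullet> T b)\<bar> \<le> 1 * 1"
          unfolding abs_mult using h1[of b] by (intro mult_mono) auto
        then show "c * (p \<bullet> T b) \<in> {- 1..1}" by (simp add: abs_le_iff)
      qed
    qed auto
    then show ?thesis unfolding continuous_on_def by (rule bspec) simp
  qed
  then have "((\<lambda>c. arccos (c * (p \<bullet> T b)) - arccos c) \<longlongrightarrow> arccos (p \<bullet> T b)) (at_left 1)"
    by (simp add: at_within_Icc_at_left)
  then have "arccos (p \<bullet> T b) \<le> \<psi> b - \<psi> a"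
    using eventually_at_left_real[of 0 1]
    by (elim tendsto_upperbound) (auto elim!: eventually_mono intro: *)
  then show ?thesis by (simp add: p_def)
qed

text \<open>If the distances of a unit vector to two others add up to at most pi, it lies in the
  hemisphere around their sum; this is the monotonicity of \<open>arccos\<close> with
  \<open>arccos (- x) = pi - arccos x\<close>.\<close>

lemma arccos_sum_le_pi:
  fixes x y :: real
  assumes "\<bar>x\<bar> \<le> 1" "\<bar>y\<bar> \<le> 1"
  shows "arccos x + arccos y \<le> pi \<Longrightarrow> 0 \<le> x + y" "arccos x + arccos y < pi \<Longrightarrow> 0 < x + y"
proof -
  have m: "arccos (- x) = pi - arccos x" using assms by (simp add: arccos_minus abs_le_iff)
  show "0 \<le> x + y" if "arccos x + arccos y \<le> pi"
  proof -
    have "(arccos y \<le> arccos (- x)) = (- x \<le> y)" using assms by (intro arccos_le_mono) auto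
    then show ?thesis using that m by linarith
  qed
  show "0 < x + y" if "arccos x + arccos y < pi"
  proof -
    have "(arccos y < arccos (- x)) = (- x < y)" using assms by (intro arccos_less_mono) auto
    then show ?thesis using that m by linarith
  qed
qed

section \<open>Fenchel's theorem and its equality case\<close>

locale unit_speed_closed_curve =
  fixes \<gamma> T T' :: "real \<Rightarrow> real^3" and L :: real
  assumes L: "0 < L" and \<gamma>: "\<And>s. (\<gamma> has_vector_derivative T s) (at s)"
    and T: "\<And>s. (T has_vector_derivative T' s) (at s)" and cT': "continuous_on UNIV T'"
    and unit: "\<And>s. norm (T s) = 1" and \<gamma>L: "\<And>s. \<gamma> (s + L) = \<gamma> s"
begin

lemma TL: "T (s + L) = T s"
  by (rule vector_derivative_shift_unique[OF \<gamma> \<gamma> \<gamma>L])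

lemma T'L: "T' (s + L) = T' s"
  by (rule vector_derivative_shift_unique[OF T T TL])

lemma T_inner_le: "\<bar>T a \<bullet> T b\<bar> \<le> 1"
  using Cauchy_Schwarz_ineq2[of "T a" "T b"] by (simp add: unit)

definition total_curvature :: real where
  "total_curvature = integral {0..L} (\<lambda>s. norm (T' s))"

text \<open>The arc length of the tangent indicatrix, up to an additive constant. It lives on the
  whole line and grows by \<open>total_curvature\<close> over each period.\<close>

definition angle :: "real \<Rightarrow> real" where
  "angle = (SOME \<psi>. \<forall>s. (\<psi> has_real_derivative norm (T' s)) (at s))"

lemma angle: "(angle has_real_derivative norm (T' s)) (at s)"
proof -
  have "\<exists>\<psi>. \<forall>s. (\<psi> has_real_derivative norm (T' s)) (at s)"
    by (rule has_real_antiderivative) (intro continuous_intros cT')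
  from someI_ex[OF this] show ?thesis unfolding angle_def by blast
qed

lemma angle_mono: "a \<le> b \<Longrightarrow> angle a \<le> angle b"
  using DERIV_nonneg_imp_nondecreasing[of a b angle] angle norm_ge_zero by blast

lemma angle_L: "angle (s + L) = angle s + total_curvature"
proof -
  have "integral {s..s + L} (\<lambda>s. norm (T' s)) = total_curvature"
    unfolding total_curvature_def using L
    by (intro integral_periodic_shift continuous_intros cT') (auto simp: T'L)
  then show ?thesis using integral_DERIV[OF angle, of s "s + L"] L by simp
qed

text \<open>The division point for Fenchel's argument, from the intermediate value theorem. It need
  not be unique, since \<open>angle\<close> may be constant on an interval.\<close>

lemma half_point:
  obtains b where "a \<le> b" "b \<le> a + L" "angle b = angle a + total_curvature / 2"
proof -
  have "0 \<le> total_curvature" using angle_mono[of a "a + L"] L by (simp add: angle_L)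
  then have "\<exists>b\<ge>a. b \<le> a + L \<and> angle b = angle a + total_curvature / 2"
    using L by (intro IVT') (auto simp: angle_L continuous_on_DERIV[OF angle])
  then show ?thesis using that by blast
qed

text \<open>A parameter up to \<open>b\<close> lies on the first half arc, a later one on the
  second, where \<open>T a\<close> is reached by going on to \<open>a + L\<close>. Either way the
  distances to the two division points add up to at most the length of that half arc.\<close>

lemma arc_bounds:
  assumes "a \<le> b" "b \<le> a + L" "angle b = angle a + total_curvature / 2" "a \<le> s" "s \<le> a + L"
  shows "arccos (T a \<bullet> T s) + arccos (T b \<bullet> T s) \<le> total_curvature / 2"
    and "arccos (T a \<bullet> T s) \<le> (if s \<le> b then angle s - angle a else angle a + total_curvature - angle s)"
    and "arccos (T b \<bullet> T s) \<le> \<bar>angle b - angle s\<bar>"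
proof -
  note arc = arccos_inner_le_arc[OF T unit angle]
  show 1: "arccos (T a \<bullet> T s) \<le> (if s \<le> b then angle s - angle a else angle a + total_curvature - angle s)"
    using arc[of a s] arc[of s "a + L"] assms by (auto simp: angle_L TL inner_commute)
  show 2: "arccos (T b \<bullet> T s) \<le> \<bar>angle b - angle s\<bar>"
    using arc[of b s] arc[of s b] by (cases "s \<le> b") (auto simp: inner_commute)
  show "arccos (T a \<bullet> T s) + arccos (T b \<bullet> T s) \<le> total_curvature / 2"
    using 1 2 angle_mono[of s b] angle_mono[of b s] assms(3) by (auto split: if_splits)
qed

lemma inner_\<gamma>_deriv: "((\<lambda>s. \<gamma> s \<bullet> v) has_real_derivative T s \<bullet> v) (at s)"
  unfolding has_real_derivative_iff_has_vector_derivative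
  by (rule bounded_linear.has_vector_derivative[OF bounded_linear_inner_left \<gamma>])

text \<open>
  If \<open>T 0\<close> and \<open>T b\<close> divide the tangent indicatrix into arcs of equal length less than \<open>pi\<close>, the
  indicatrix lies in the open hemisphere around \<open>T 0 + T b\<close>, which is impossible for a closed curve.
\<close>
theorem Fenchel: "2 * pi \<le> total_curvature"
proof (rule ccontr)
  assume less: "\<not> 2 * pi \<le> total_curvature"
  obtain b where b: "0 \<le> b" "b \<le> 0 + L" "angle b = angle 0 + total_curvature / 2"
    by (rule half_point[of 0])
  have "\<gamma> 0 \<bullet> (T 0 + T b) < \<gamma> L \<bullet> (T 0 + T b)"
  proof (rule DERIV_pos_imp_increasing[OF L])
    fix s assume "0 \<le> s" "s \<le> L"
    then have "arccos (T 0 \<bullet> T s) + arccos (T b \<bullet> T s) < pi"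
      using arc_bounds(1)[OF b, of s] less by simp
    then have "0 < T 0 \<bullet> T s + T b \<bullet> T s"
      by (rule arccos_sum_le_pi(2)[OF T_inner_le T_inner_le])
    then have "0 < T s \<bullet> (T 0 + T b)"
      by (simp add: inner_commute inner_add_right)
    then show "\<exists>y. ((\<lambda>s. \<gamma> s \<bullet> (T 0 + T b)) has_real_derivative y) (at s) \<and> 0 < y"
      using inner_\<gamma>_deriv by blast
  qed
  then show False using \<gamma>L[of 0] by simp
qed

text \<open>
  The second alternative occurs when the two division points are antipodal, so that the hemisphere
  degenerates and both arcs have to be great semicircles.
\<close>
lemma Fenchel_equality_cases:
  assumes eq: "total_curvature = 2 * pi"
  shows "(\<exists>v. v \<noteq> 0 \<and> (\<forall>s. T s \<bullet> v = 0)) \<or> (\<forall>s\<in>{a..a + L}. T a \<bullet> T s = cos (angle s - angle a))"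
proof -
  obtain b where b: "a \<le> b" "b \<le> a + L" "angle b = angle a + total_curvature / 2"
    by (rule half_point[of a])
  define v where "v = T a + T b"
  show ?thesis
  proof (cases "v = 0")
    case False
    have nonneg: "0 \<le> T s \<bullet> v" if "s \<in> {a..a + L}" for s
    proof -
      have "arccos (T a \<bullet> T s) + arccos (T b \<bullet> T s) \<le> pi"
        using arc_bounds(1)[OF b, of s] that eq by simp
      then have "0 \<le> T a \<bullet> T s + T b \<bullet> T s"
        by (rule arccos_sum_le_pi(1)[OF T_inner_le T_inner_le])
      then show ?thesis by (simp add: v_def inner_commute inner_add_right)
    qed
    \<comment> \<open>A function that is both monotone over a period and periodic is constant, so
      its derivative, the component of \<open>T\<close> along \<open>v\<close>, vanishes.\<close>
    have mono: "\<gamma> x \<bullet> v \<le> \<gamma> y \<bullet> v" if "a \<le> x" "x \<le> y" "y \<le> a + L" for x y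
      using that nonneg inner_\<gamma>_deriv
      by (intro DERIV_nonneg_imp_nondecreasing[of x y "\<lambda>s. \<gamma> s \<bullet> v"]) force+
    have "\<gamma> x \<bullet> v = \<gamma> a \<bullet> v" for x
    proof -
      obtain y where y: "y \<in> {a..a + L}" "\<And>f::real \<Rightarrow> real. (\<And>x. f (x + L) = f x) \<Longrightarrow> f x = f y"
        using periodic_reduce[OF L] by metis
      have "\<gamma> x \<bullet> v = \<gamma> y \<bullet> v"
        by (rule y(2)[of "\<lambda>x. \<gamma> x \<bullet> v"]) (simp add: \<gamma>L)
      also have "\<dots> = \<gamma> a \<bullet> v"
        using mono[of a y] mono[of y "a + L"] y(1) L by (simp add: \<gamma>L)
      finally show ?thesis .
    qed
    then have "(\<lambda>x. \<gamma> x \<bullet> v) = (\<lambda>x. \<gamma> a \<bullet> v)" by blast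
    then have "T s \<bullet> v = 0" for s
      using inner_\<gamma>_deriv[of v s] DERIV_unique[OF _ DERIV_const] by simp
    then show ?thesis using False by blast
  next
    case True
    then have Tb: "T b = - T a" unfolding v_def by (simp add: eq_neg_iff_add_eq_0 add.commute)
    have "T a \<bullet> T s = cos (angle s - angle a)" if "s \<in> {a..a + L}" for s
    proof -
      have s: "a \<le> s" "s \<le> a + L" using that by auto
      \<comment> \<open>For antipodal division points the upper bound on the distance to
        \<open>T b\<close> is a lower bound on the distance to \<open>T a\<close>, and it meets the
        upper bound.\<close>
      have "arccos (T b \<bullet> T s) = pi - arccos (T a \<bullet> T s)"
        using T_inner_le[of a s] by (simp add: Tb arccos_minus abs_le_iff)
      then have "arccos (T a \<bullet> T s) = (if s \<le> b then angle s - angle a else angle a + 2 * pi - angle s)"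
        using arc_bounds(2,3)[OF b s] b(3) eq angle_mono[of s b] angle_mono[of b s]
        by (auto split: if_splits)
      then have "cos (arccos (T a \<bullet> T s)) = cos (angle s - angle a)"
        using cos_minus[of "angle s - angle a"] cos_periodic[of "angle a - angle s"]
        by (auto simp: algebra_simps)
      then show ?thesis using T_inner_le[of a s] by (simp add: abs_le_iff)
    qed
    then show ?thesis by blast
  qed
qed

text \<open>If no normal vector exists, the second alternative of
  \<open>Fenchel_equality_cases\<close> holds for every base point at once. Two base points a
  quarter turn apart then give both coordinates of \<open>T\<close>, which puts it on a great circle
  after all.\<close>

theorem Fenchel_equality_planar:
  assumes eq: "total_curvature = 2 * pi"
  shows "\<exists>v. v \<noteq> 0 \<and> (\<forall>s. T s \<bullet> v = 0)"
proof (rule ccontr)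
  assume not: "\<not> ?thesis"
  then have circ: "T a \<bullet> T s = cos (angle s - angle a)" if "s \<in> {a..a + L}" for a s
    using Fenchel_equality_cases[OF eq] that by blast
  \<comment> \<open>For a parameter before the base point, one period is added; \<open>angle\<close>
    then grows by 2 pi, which the cosine does not see.\<close>
  have circ': "T a \<bullet> T s = cos (angle s - angle a)" if "0 \<le> a" "a \<le> L" "0 \<le> s" "s \<le> L" for a s
  proof (cases "a \<le> s")
    case True
    then show ?thesis using circ[of s a] that by simp
  next
    case False
    then have "T a \<bullet> T (s + L) = cos (angle (s + L) - angle a)"
      using that by (intro circ) auto
    moreover have "cos (angle (s + L) - angle a) = cos (angle s - angle a)"
      unfolding angle_L eq using cos_periodic[of "angle s - angle a"] by (simp add: algebra_simps)
    ultimately show ?thesis by (simp only: TL)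
  qed
  have "\<exists>c\<ge>0. c \<le> L \<and> angle c = angle 0 + pi / 2"
    using L angle_L[of 0] by (intro IVT') (auto simp: eq continuous_on_DERIV[OF angle])
  then obtain c where c: "0 \<le> c" "c \<le> L" "angle c = angle 0 + pi / 2" by blast
  have e12: "T 0 \<bullet> T c = 0" using circ'[of 0 c] c L by simp
  have n1: "T s \<bullet> T s = 1" for s using unit by (simp add: norm_eq_1)
  have Ts: "T s = cos (angle s - angle 0) *\<^sub>R T 0 + sin (angle s - angle 0) *\<^sub>R T c" if "0 \<le> s" "s \<le> L" for s
  proof -
    let ?C = "cos (angle s - angle 0)" and ?S = "sin (angle s - angle 0)"
    have 1: "T 0 \<bullet> T s = ?C" using circ'[of 0 s] that L by simp
    have c': "angle s - angle c = (angle s - angle 0) - pi / 2" using c by simp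
    have "cos (angle s - angle c) = ?S"
      unfolding c' cos_diff[of "angle s - angle 0" "pi / 2"] by simp
    then have 2: "T c \<bullet> T s = ?S"
      using circ'[of c s] that c by simp
    \<comment> \<open>The two coordinates already use up the length 1 of \<open>T s\<close>, so the
      remainder has length zero.\<close>
    have "(T s - (?C *\<^sub>R T 0 + ?S *\<^sub>R T c)) \<bullet> (T s - (?C *\<^sub>R T 0 + ?S *\<^sub>R T c)) = 1 - (?C\<^sup>2 + ?S\<^sup>2)"
      using 1 2 e12 n1 inner_commute[of "T 0" "T s"] inner_commute[of "T c" "T s"] inner_commute[of "T c" "T 0"]
      by (simp add: inner_diff_left inner_diff_right inner_add_left inner_add_right power2_eq_square algebra_simps)
    then show ?thesis by simp
  qed
  define v where "v = cross3 (T 0) (T c)"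
  have v0: "v \<noteq> 0"
  proof
    assume "v = 0"
    then show False
      using norm_cross_dot[of "T 0" "T c"] unit e12 by (simp add: v_def)
  qed
  have "T s \<bullet> v = 0" for s
  proof -
    obtain y where y: "y \<in> {0..0 + L}" "\<And>f::real \<Rightarrow> real. (\<And>x. f (x + L) = f x) \<Longrightarrow> f s = f y"
      using periodic_reduce[OF L] by metis
    have "T s \<bullet> v = T y \<bullet> v"
      by (rule y(2)[of "\<lambda>x. T x \<bullet> v"]) (simp add: TL)
    also have "\<dots> = 0"
      using y(1) by (subst Ts) (auto simp: inner_add_left v_def dot_cross_self)
    finally show ?thesis .
  qed
  then show False using not v0 by blast
qed

end

section \<open>Curves on the sphere with planar trace or constant curvature\<close>

text \<open>A vector orthogonal to x and y is parallel to their cross product. The squared length as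
  a factor avoids a division; in the applications it is 1.\<close>

lemma orthogonal_complement_cross:
  fixes w x y :: "real^3"
  assumes "w \<bullet> x = 0" "w \<bullet> y = 0"
  shows "(norm (cross3 x y))\<^sup>2 *\<^sub>R w = (w \<bullet> cross3 x y) *\<^sub>R cross3 x y"
proof -
  have "cross3 w (cross3 x y) = 0"
    by (simp add: Lagrange assms)
  then have "cross3 (cross3 x y) w = 0"
    using cross_skew[of "cross3 x y" w] by simp
  then have "cross3 (cross3 x y) (cross3 (cross3 x y) w) = 0" by simp
  then show ?thesis
    unfolding Lagrange by (simp add: power2_norm_eq_inner inner_commute)
qed

lemma has_vector_derivative_inner:
  fixes f g :: "real \<Rightarrow> 'a::real_inner"
  assumes "(f has_vector_derivative f') (at s)" "(g has_vector_derivative g') (at s)"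
  shows "((\<lambda>s. f s \<bullet> g s) has_vector_derivative f s \<bullet> g' + f' \<bullet> g s) (at s)"
  by (rule bounded_bilinear.has_vector_derivative[OF bounded_bilinear_inner assms])

lemma inner_const_imp:
  fixes f g :: "real \<Rightarrow> 'a::real_inner"
  assumes "\<And>s. (f has_vector_derivative f' s) (at s)" "\<And>s. (g has_vector_derivative g' s) (at s)"
    and "\<And>s. f s \<bullet> g s = c"
  shows "f s \<bullet> g' s + f' s \<bullet> g s = 0"
proof -
  have "(\<lambda>s. f s \<bullet> g s) = (\<lambda>_. c)" using assms(3) by blast
  then show ?thesis
    using has_vector_derivative_inner[OF assms(1,2), of s]
      vector_derivative_unique_at[OF _ has_vector_derivative_const] by metis
qed

locale unit_speed_spherical_curve = unit_speed_closed_curve +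
  assumes sphere: "\<And>s. norm (\<gamma> s) = 1"
begin

text \<open>The last three follow by differentiating constant inner products. The value -1 says that
  the normal component of the acceleration is that of a great circle.\<close>

lemma frame: "\<gamma> s \<bullet> \<gamma> s = 1" "T s \<bullet> T s = 1" "\<gamma> s \<bullet> T s = 0" "T s \<bullet> T' s = 0" "\<gamma> s \<bullet> T' s = - 1"
proof -
  show 1: "\<gamma> s \<bullet> \<gamma> s = 1" "T s \<bullet> T s = 1" for s using sphere unit by (simp_all add: norm_eq_1)
  show 2: "\<gamma> s \<bullet> T s = 0" for s using inner_const_imp[OF \<gamma> \<gamma> 1(1), of s] by (simp add: inner_commute)
  show "T s \<bullet> T' s = 0" using inner_const_imp[OF T T 1(2), of s] by (simp add: inner_commute)
  show "\<gamma> s \<bullet> T' s = - 1" using inner_const_imp[OF \<gamma> T 2, of s] by (simp add: 1)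
qed

lemma frame_commuted: "T s \<bullet> \<gamma> s = 0" "T' s \<bullet> T s = 0" "T' s \<bullet> \<gamma> s = - 1"
  using frame(3,4,5)[of s] by (simp_all add: inner_commute)

lemma one_le_curvature: "1 \<le> norm (T' s)"
  using Cauchy_Schwarz_ineq2[of "\<gamma> s" "T' s"] by (simp add: frame sphere)

text \<open>The curve lies in a plane with unit normal n at height d = \<gamma> 0 \<bullet> n, hence
  on a circle of radius sqrt (1 - d^2). Both the radius vector \<open>G\<close> and
  \<open>T'\<close> are multiples of \<open>B\<close>, and \<open>G \<bullet> T' s = - 1\<close>
  makes their lengths reciprocal.\<close>

lemma planar_imp_constant_curvature:
  assumes v0: "v \<noteq> 0" and v: "\<And>s. T s \<bullet> v = 0"
  shows "norm (T' s) = norm (T' r)"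
proof -
  define n where "n = v /\<^sub>R norm v"
  have n: "n \<bullet> n = 1" "\<And>s. T s \<bullet> n = 0"
    using v0 v by (simp_all add: n_def dot_square_norm power2_eq_square field_simps)
  have n': "n \<bullet> T s = 0" for s
    using n(2)[of s] by (simp add: inner_commute)
  have "((\<lambda>s. \<gamma> s \<bullet> n) has_vector_derivative 0) (at s)" for s
    using has_vector_derivative_inner[OF \<gamma> has_vector_derivative_const[of n], of s] n(2) by simp
  then have d: "\<gamma> s \<bullet> n = \<gamma> 0 \<bullet> n" for s
    by (rule vector_derivative_zero_imp_constant)
  have T'n: "T' s \<bullet> n = 0" for s
    using inner_const_imp[OF T has_vector_derivative_const[of n] n(2), of s] by simp
  have "(norm (T' s))\<^sup>2 * (1 - (\<gamma> 0 \<bullet> n)\<^sup>2) = 1" for s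
  proof -
    define B where "B = cross3 n (T s)"
    define G where "G = \<gamma> s - (\<gamma> 0 \<bullet> n) *\<^sub>R n"
    have "norm n = 1" using n(1) by (simp add: norm_eq_1)
    then have B: "(norm B)\<^sup>2 = 1"
      using norm_cross_dot[of n "T s"] n(2) unit[of s] by (simp add: B_def inner_commute)
    have "G \<bullet> n = 0" "G \<bullet> T s = 0"
      unfolding G_def by (simp_all add: inner_diff_left d[of s] n n' frame)
    then have G: "G = (G \<bullet> B) *\<^sub>R B"
      using orthogonal_complement_cross[of G n "T s"] B by (simp add: B_def)
    have K: "T' s = (T' s \<bullet> B) *\<^sub>R B"
      using orthogonal_complement_cross[of "T' s" n "T s"] B by (simp add: B_def T'n frame_commuted)
    have BB: "B \<bullet> B = 1" using B by (simp add: power2_norm_eq_inner)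
    have "- 1 = G \<bullet> T' s"
      unfolding G_def by (simp add: inner_diff_left frame inner_commute[of n] T'n)
    also have "\<dots> = (G \<bullet> B) * (T' s \<bullet> B)"
      by (subst G, subst K) (simp add: BB)
    finally have "(G \<bullet> B) * (T' s \<bullet> B) = - 1" by (rule sym)
    then have "((G \<bullet> B) * (T' s \<bullet> B))\<^sup>2 = 1" by simp
    moreover have "(norm (T' s))\<^sup>2 = (T' s \<bullet> B)\<^sup>2"
      by (subst K) (simp add: power_mult_distrib B)
    moreover have "(G \<bullet> B)\<^sup>2 = G \<bullet> G"
      by (subst (2 3) G) (simp add: BB power2_eq_square)
    moreover have "G \<bullet> G = 1 - (\<gamma> 0 \<bullet> n)\<^sup>2"
      unfolding G_def using d[of s]
      by (simp add: inner_diff_left inner_diff_right frame n inner_commute power2_eq_square algebra_simps)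
    ultimately show ?thesis by (simp add: power_mult_distrib mult.commute)
  qed
  \<comment> \<open>The product being 1 shows that the common factor is nonzero, so it
    cancels.\<close>
  from this[of s] this[of r] have "(norm (T' s))\<^sup>2 = (norm (T' r))\<^sup>2"
    by (metis mult_right_cancel mult_zero_right zero_neq_one)
  then show ?thesis by simp
qed

text \<open>Constant curvature makes the geodesic curvature constant, and the frame equations then
  give \<open>T'' = - \<kappa>\<^sup>2 T\<close>, an oscillator of period 2 pi / \<kappa>. Two
  conserved vectors carry this period over from \<open>T'\<close> to
  \<open>\<gamma>\<close>.\<close>

lemma constant_curvature_closes_up:
  assumes \<kappa>: "\<And>s. norm (T' s) = \<kappa>"
  shows "\<gamma> (2 * pi / \<kappa>) = \<gamma> 0"
proof -
  have \<kappa>1: "1 \<le> \<kappa>" using one_le_curvature \<kappa> by metis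
  define B where "B = (\<lambda>s. cross3 (\<gamma> s) (T s))"
  \<comment> \<open>The geodesic curvature of the curve in the sphere.\<close>
  define k where "k = (\<lambda>s. T' s \<bullet> B s)"
  have "(norm (B s))\<^sup>2 = 1\<^sup>2" for s
    using norm_cross_dot[of "\<gamma> s" "T s"] by (simp add: B_def sphere unit frame)
  then have B: "norm (B s) = 1" "\<gamma> s \<bullet> B s = 0" for s
    using power2_eq_imp_eq[of "norm (B s)" 1] by (simp_all add: B_def dot_cross_self)
  have T': "T' s = - \<gamma> s + k s *\<^sub>R B s" for s
  proof -
    have "(norm (B s))\<^sup>2 *\<^sub>R (T' s + \<gamma> s) = ((T' s + \<gamma> s) \<bullet> B s) *\<^sub>R B s"
      unfolding B_def
      by (rule orthogonal_complement_cross) (simp_all add: inner_add_left frame frame_commuted)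
    then have "T' s + \<gamma> s = k s *\<^sub>R B s" by (simp add: k_def inner_add_left B)
    then show ?thesis by (simp add: algebra_simps eq_neg_iff_add_eq_0)
  qed
  have k2: "(k s)\<^sup>2 = \<kappa>\<^sup>2 - 1" for s
  proof -
    have "\<kappa>\<^sup>2 = T' s \<bullet> T' s" using \<kappa>[of s] by (simp add: power2_norm_eq_inner[symmetric])
    also have "\<dots> = 1 + (k s)\<^sup>2"
      using B[of s] unfolding T'
      by (simp add: inner_diff_left inner_diff_right inner_add_left inner_add_right frame
          inner_commute norm_eq_1 power2_eq_square)
    finally show ?thesis by simp
  qed
  have dB: "(B has_vector_derivative cross3 (\<gamma> s) (T' s)) (at s)" for s
    using bounded_bilinear.has_vector_derivative[OF bilinear_conv_bounded_bilinear[THEN iffD1, OF bilinear_cross] \<gamma>[of s] T[of s]]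
    by (simp add: B_def)
  have ck: "continuous_on UNIV k"
    unfolding k_def
    by (intro continuous_intros cT' continuous_on_vector_derivative[OF has_vector_derivative_at_within[OF dB]])
  \<comment> \<open>Only the square of \<open>k\<close> is known to be constant; continuity on a
    connected line excludes a change of sign.\<close>
  have "k ` UNIV \<subseteq> {sqrt (\<kappa>\<^sup>2 - 1), - sqrt (\<kappa>\<^sup>2 - 1)}"
  proof
    fix x assume "x \<in> k ` UNIV"
    then have "x\<^sup>2 = \<kappa>\<^sup>2 - 1" using k2 by auto
    then have "\<bar>x\<bar> = sqrt (\<kappa>\<^sup>2 - 1)" by (metis real_sqrt_abs)
    then show "x \<in> {sqrt (\<kappa>\<^sup>2 - 1), - sqrt (\<kappa>\<^sup>2 - 1)}" by auto
  qed
  then have "finite (k ` UNIV)" by (rule finite_subset) simp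
  from continuous_finite_range_constant[OF connected_UNIV ck this]
  obtain c where c: "\<And>s. k s = c" unfolding constant_on_def by blast
  have \<kappa>c: "\<kappa>\<^sup>2 = 1 + c\<^sup>2" using k2[of 0] by (simp add: c)
  have "cross3 (\<gamma> s) (T' s) = - c *\<^sub>R T s" for s
    unfolding T' B_def
    by (simp add: Cross3.right_diff_distrib cross_mult_right Lagrange frame c)
  then have "(B has_vector_derivative - c *\<^sub>R T s) (at s)" for s
    using dB by metis
  then have "((\<lambda>s. - \<gamma> s + c *\<^sub>R B s) has_vector_derivative - T s + c *\<^sub>R (- c *\<^sub>R T s)) (at s)" for s
    by (intro has_vector_derivative_add has_vector_derivative_minus \<gamma>
        bounded_linear.has_vector_derivative[OF bounded_linear_scaleR_right])
  moreover have "(\<lambda>s. - \<gamma> s + c *\<^sub>R B s) = T'" using T' c by auto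
  moreover have "- T s + c *\<^sub>R (- c *\<^sub>R T s) = - (\<kappa>\<^sup>2) *\<^sub>R T s" for s
    unfolding \<kappa>c by (simp add: power2_eq_square algebra_simps)
  ultimately have dT': "(T' has_vector_derivative - (\<kappa>\<^sup>2) *\<^sub>R T s) (at s)" for s by simp
  \<comment> \<open>The initial value \<open>T' 0\<close> expressed through \<open>T\<close> and
    \<open>T'\<close> at time s by the solution formula of the oscillator.\<close>
  define b where "b = (\<lambda>s. (\<kappa> * sin (\<kappa> * s)) *\<^sub>R T s + cos (\<kappa> * s) *\<^sub>R T' s)"
  have "(b has_vector_derivative 0) (at s)" for s
  proof -
    have 1: "((\<lambda>s. \<kappa> * sin (\<kappa> * s)) has_real_derivative \<kappa> * (cos (\<kappa> * s) * \<kappa>)) (at s)"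
      "((\<lambda>s. cos (\<kappa> * s)) has_real_derivative - sin (\<kappa> * s) * \<kappa>) (at s)"
      by (auto intro!: derivative_eq_intros)
    show ?thesis
      unfolding b_def
      by (rule has_vector_derivative_eq_rhs,
          rule has_vector_derivative_add[OF has_vector_derivative_scaleR[OF 1(1) T]
            has_vector_derivative_scaleR[OF 1(2) dT']])
        (simp add: algebra_simps power2_eq_square)
  qed
  then have "b (2 * pi / \<kappa>) = b 0" by (rule vector_derivative_zero_imp_constant)
  then have "T' (2 * pi / \<kappa>) = T' 0" using \<kappa>1 by (simp add: b_def)
  \<comment> \<open>This conserved vector is \<kappa>^2 times the centre of the circle.\<close>
  moreover have "((\<lambda>s. \<kappa>\<^sup>2 *\<^sub>R \<gamma> s + T' s) has_vector_derivative \<kappa>\<^sup>2 *\<^sub>R T s + - (\<kappa>\<^sup>2) *\<^sub>R T s) (at s)" for s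
    by (intro has_vector_derivative_add dT'
        bounded_linear.has_vector_derivative[OF bounded_linear_scaleR_right \<gamma>])
  then have "\<kappa>\<^sup>2 *\<^sub>R \<gamma> (2 * pi / \<kappa>) + T' (2 * pi / \<kappa>) = \<kappa>\<^sup>2 *\<^sub>R \<gamma> 0 + T' 0"
    using vector_derivative_zero_imp_constant[of "\<lambda>s. \<kappa>\<^sup>2 *\<^sub>R \<gamma> s + T' s"] by simp
  ultimately show ?thesis using \<kappa>1 by simp
qed

end

section \<open>The eigenvalue bound and its equality case\<close>

lemma arclength_closed_curveD:
  assumes "arclength_closed_curve \<gamma> L"
  defines "T \<equiv> \<lambda>s. vector_derivative \<gamma> (at s)"
  defines "T' \<equiv> \<lambda>s. vector_derivative T (at s)"
  shows "unit_speed_closed_curve \<gamma> T T' L"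
proof
  have sm: "((\<lambda>g u. vector_derivative g (at u)) ^^ n) \<gamma> differentiable (at x)" for n x
    using assms(1) by (simp add: arclength_closed_curve_def smooth_def)
  show "(\<gamma> has_vector_derivative T s) (at s)" for s
    unfolding T_def using sm[of 0 s] by (simp add: vector_derivative_works)
  show "(T has_vector_derivative T' s) (at s)" for s
    unfolding T'_def using sm[of 1 s] by (simp add: T_def vector_derivative_works)
  have "T' differentiable (at s)" for s
    unfolding T'_def T_def using sm[of 2 s] by (simp add: numeral_2_eq_2)
  then show "continuous_on UNIV T'"
    by (simp add: continuous_on_eq_continuous_at differentiable_imp_continuous_within)
qed (use assms in \<open>auto simp: arclength_closed_curve_def\<close>)

theorem theorem2:
  fixes \<gamma> :: "real \<Rightarrow> real^3" and L A :: real and \<Omega> :: "(real^3) set"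
  assumes "arclength_closed_curve \<gamma> L"
    and "range \<gamma> \<subseteq> sphere 0 1"
    and "bounds_region (range \<gamma>) \<Omega>"
    and "A = sphere_area \<Omega>"
  shows "\<exists>\<mu>\<^sub>1. first_eigenvalue (periodic_C2 L) (P_op A L (curvature \<gamma>)) \<mu>\<^sub>1 \<and>
      4 * pi\<^sup>2 / L\<^sup>2 \<le> \<mu>\<^sub>1 \<and>
      (\<mu>\<^sub>1 = 4 * pi\<^sup>2 / L\<^sup>2 \<longleftrightarrow> curvature \<gamma> constant_on {0..L})"
proof -
  define T where "T = (\<lambda>s. vector_derivative \<gamma> (at s))"
  define T' where "T' = (\<lambda>s. vector_derivative T (at s))"
  interpret unit_speed_closed_curve \<gamma> T T' L
    using arclength_closed_curveD[OF assms(1)] by (simp add: T_def T'_def)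
  interpret unit_speed_spherical_curve \<gamma> T T' L
  proof
    have "\<gamma> s \<in> sphere 0 1" for s using assms(2) by blast
    then show "norm (\<gamma> s) = 1" for s by simp
  qed
  have inj: "inj_on \<gamma> {0..<L}" using assms(1) by (simp add: arclength_closed_curve_def)
  define \<kappa> where "\<kappa> = curvature \<gamma>"
  have \<kappa>_eq: "\<kappa> = (\<lambda>s. norm (T' s))"
    by (simp add: \<kappa>_def T'_def T_def curvature_def fun_eq_iff)
  have c\<kappa>: "continuous_on UNIV \<kappa>" unfolding \<kappa>_eq by (intro continuous_intros cT')
  have \<kappa>L: "\<kappa> (s + L) = \<kappa> s" for s by (simp add: \<kappa>_eq T'L)
  interpret periodic_potential L "\<lambda>s. (\<kappa> s)\<^sup>2"
    by unfold_locales (auto intro!: continuous_intros c\<kappa> L simp: \<kappa>L)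
  obtain \<mu> g g' where gpos: "\<And>s. 0 < g s" and g: "\<And>s. (g has_real_derivative g' s) (at s)"
      "\<And>s. (g' has_real_derivative ((\<kappa> s)\<^sup>2 - \<mu>) / 4 * g s) (at s)" "\<And>s. g (s + L) = g s"
    using ground_state_exists by blast
  have cg: "continuous_on UNIV g" and cg': "continuous_on UNIV g'"
    by (rule continuous_on_DERIV, fact)+
  have cg'': "continuous_on UNIV (\<lambda>s. ((\<kappa> s)\<^sup>2 - \<mu>) / 4 * g s)"
    by (intro continuous_intros c\<kappa> cg) simp
  have g'L: "g' (s + L) = g' s" for s
    using admissible_derivative_periodic[of g g'] g cg' by (simp add: admissible_def)
  note int = integrable_continuous_UNIV continuous_on_add continuous_on_mult continuous_on_diff
    continuous_on_power
  have "g \<noteq> (\<lambda>s. 0)" using gpos[of 0] by auto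
  then have first: "first_eigenvalue (periodic_C2 L) (P_op A L \<kappa>) \<mu>"
    unfolding first_eigenvalue_def
    using ground_state_eigenvalue[OF c\<kappa> _ g] torus_spectrum_bound[OF L c\<kappa> gpos g g'L] by blast
  define N where "N = integral {0..L} (\<lambda>s. (g s)\<^sup>2)"
  have positive: "0 < integral {0..L} h" if "continuous_on UNIV h" "\<And>s. 0 < h s" for h :: "real \<Rightarrow> real"
    using integral_less_real[of 0 L "\<lambda>_. 0" h] that L continuous_on_subset[OF that(1)] by auto
  have N: "0 < N"
    unfolding N_def by (rule positive[OF continuous_on_power[OF cg] zero_less_power[OF gpos]])
  define c where "c = 2 * pi / total_curvature"
  have tc: "2 * pi \<le> total_curvature" by (rule Fenchel)
  then have tc0: "0 < total_curvature" using pi_gt_zero by linarith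
  have c0: "0 < c" and c1: "c \<le> 1" using tc tc0 by (simp_all add: c_def)
  then have c2: "c\<^sup>2 \<le> 1" by (simp add: power_le_one)
  define I where "I = integral {0..L} (\<lambda>s. (\<kappa> s)\<^sup>2 * (g s)\<^sup>2)"
  have I: "0 < I"
    unfolding I_def
    by (rule positive)
      (use gpos one_le_curvature order_less_le_trans[OF zero_less_one] in
        \<open>auto intro!: continuous_intros cg cT' mult_pos_pos zero_less_power simp: \<kappa>_eq\<close>)
  have split: "integral {0..L} (\<lambda>s. 4 * (g' s)\<^sup>2 + a * (\<kappa> s)\<^sup>2 * (g s)\<^sup>2) = 4 * integral {0..L} (\<lambda>s. (g' s)\<^sup>2) + a * I" for a
  proof -
    have "(\<lambda>s. 4 * (g' s)\<^sup>2 + a * (\<kappa> s)\<^sup>2 * (g s)\<^sup>2) = (\<lambda>s. 4 * (g' s)\<^sup>2 + a * ((\<kappa> s)\<^sup>2 * (g s)\<^sup>2))"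
      by (simp add: mult.assoc)
    then show ?thesis unfolding I_def by (simp add: integral_add int cg cg' c\<kappa>)
  qed
  \<comment> \<open>The equation of \<open>g\<close>, multiplied by \<open>g\<close> and integrated
    over a period.\<close>
  have energy_eq: "4 * integral {0..L} (\<lambda>s. (g' s)\<^sup>2) + I = \<mu> * N"
  proof -
    have "- integral {0..L} (\<lambda>s. g' s * g' s) = integral {0..L} (\<lambda>s. (((\<kappa> s)\<^sup>2 - \<mu>) / 4 * g s) * g s)"
      using L by (intro integral_by_parts_periodic[symmetric] g g'L cg' cg'') auto
    also have "(\<lambda>s. (((\<kappa> s)\<^sup>2 - \<mu>) / 4 * g s) * g s) = (\<lambda>s. (1/4) * ((\<kappa> s)\<^sup>2 * (g s)\<^sup>2) - (\<mu>/4) * (g s)\<^sup>2)"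
      by (simp add: fun_eq_iff field_simps power2_eq_square)
    also have "integral {0..L} \<dots> = (1/4) * I - (\<mu>/4) * N"
      unfolding I_def N_def by (subst integral_diff) (auto intro!: int cg c\<kappa>)
    finally show ?thesis by (simp add: power2_eq_square field_simps)
  qed
  have "c * integral {0..L} \<kappa> = 2 * pi"
    using tc0 by (simp add: c_def total_curvature_def \<kappa>_eq)
  from half_angle_inequality[OF g(1) cg' c\<kappa> g(3) g'L \<kappa>L L this]
  have half: "4 * pi\<^sup>2 / L\<^sup>2 * N \<le> 4 * integral {0..L} (\<lambda>s. (g' s)\<^sup>2) + c\<^sup>2 * I"
    unfolding split N_def .
  \<comment> \<open>The left-hand side is the gap between the potentials \<kappa>^2 and c^2
    \<kappa>^2. Since it is kept, one inequality serves both the bound and the equality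
    case.\<close>
  have key: "(1 - c\<^sup>2) * I \<le> (\<mu> - 4 * pi\<^sup>2 / L\<^sup>2) * N"
    using half energy_eq by (simp add: algebra_simps)
  moreover have "0 \<le> (1 - c\<^sup>2) * I" using c2 I by simp
  ultimately have lower: "4 * pi\<^sup>2 / L\<^sup>2 \<le> \<mu>"
    using N by (smt (verit) mult_neg_pos)
  have "\<kappa> constant_on {0..L}" if eq: "\<mu> = 4 * pi\<^sup>2 / L\<^sup>2"
  proof -
    have "1 \<le> c\<^sup>2" using key I eq by (simp add: mult_le_0_iff)
    then have "1 \<le> c" using c0 c1 by (smt (verit) power_less_one_iff zero_less_numeral pos2)
    then have "total_curvature = 2 * pi" using c1 tc0 by (simp add: c_def field_simps)
    from Fenchel_equality_planar[OF this] obtain v where "v \<noteq> 0" "\<And>s. T s \<bullet> v = 0" by blast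
    from planar_imp_constant_curvature[OF this] show ?thesis
      unfolding constant_on_def \<kappa>_eq by blast
  qed
  moreover have "\<mu> = 4 * pi\<^sup>2 / L\<^sup>2" if const: "\<kappa> constant_on {0..L}"
  proof -
    obtain k where k: "\<And>s. s \<in> {0..L} \<Longrightarrow> \<kappa> s = k" using const by (auto simp: constant_on_def)
    have \<kappa>k: "\<kappa> s = k" for s
    proof -
      obtain y where "y \<in> {0..0 + L}" "\<And>f::real \<Rightarrow> real. (\<And>x. f (x + L) = f x) \<Longrightarrow> f s = f y"
        using periodic_reduce[OF L] by metis
      from this(1) this(2)[of \<kappa>, OF \<kappa>L] show ?thesis using k by simp
    qed
    have k1: "1 \<le> k" using one_le_curvature \<kappa>k unfolding \<kappa>_eq by metis
    \<comment> \<open>The integral of the second derivative over a period is zero, and for constant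
      curvature the factor \<open>k\<^sup>2 - \<mu>\<close> comes out in front of the positive
      integral of \<open>g\<close>.\<close>
    have "integral {0..L} (\<lambda>s. ((\<kappa> s)\<^sup>2 - \<mu>) / 4 * g s) = g' L - g' 0"
      using L by (intro integral_DERIV g) auto
    then have "(k\<^sup>2 - \<mu>) / 4 * integral {0..L} g = 0"
      using g'L[of 0] by (simp add: \<kappa>k)
    moreover have "0 < integral {0..L} g" by (rule positive[OF cg gpos])
    ultimately have \<mu>: "\<mu> = k\<^sup>2" by simp
    have "\<gamma> (2 * pi / k) = \<gamma> 0"
      using constant_curvature_closes_up \<kappa>k unfolding \<kappa>_eq by blast
    \<comment> \<open>A simple curve cannot return to its starting point strictly within the period.
      This bounds \<mu> from above only; the other inequality is \<open>lower\<close>.\<close>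
    then have "\<not> 2 * pi / k < L"
      using inj_onD[OF inj, of "2 * pi / k" 0] k1 L by auto
    then have "k * L \<le> 2 * pi" using k1 by (simp add: field_simps)
    then have "(k * L)\<^sup>2 \<le> (2 * pi)\<^sup>2" using k1 L by (intro power_mono) auto
    then have "\<mu> \<le> 4 * pi\<^sup>2 / L\<^sup>2"
      using L by (simp add: \<mu> power_mult_distrib field_simps)
    then show ?thesis using lower by simp
  qed
  ultimately show ?thesis using first lower unfolding \<kappa>_def by blast
qed

end
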